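(* Let $G$ be a connected graph of order $n$ that contains no $6$-cycle (that is, no cycle of length $6$ as a subgraph, induced or not). If $G$ is not isomorphic to any of $P_3$, $C_3$, $C_7$, $C_{11}$, then $\iota_1(G) \leq \frac{n}{4}$.
   Context: All graphs are finite, simple and undirected (with at least one vertex). The order of a graph $G$ is $|V(G)|$. $P_n$ and $C_n$ denote the path and the cycle on $n$ vertices, respectively. For $D \subseteq V(G)$, $N[D]$ denotes the closed neighborhood of $D$, i.e. the set of vertices that lie in $D$ or are adjacent to a vertex of $D$; $G-N[D]$ is the graph obtained from $G$ by deleting all vertices of $N[D]$. A subset $D \subseteq V(G)$ is a $1$-isolating set of $G$ if $\Delta(G-N[D]) \leq 1$ (where $\Delta$ is the maximum degree), i.e. $G-N[D]$ consists of isolated edges and isolated vertices only (possibly $G-N[D]$ has no vertices). The $1$-isolation number $\iota_1(G)$ is the minimum cardinality of a $1$-isolating set of $G$ (the empty set is allowed as a $1$-isolating set, so e.g. $\iota_1(K_1)=\iota_1(K_2)=0$). *)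

theory Defs
  imports Complex_Main "Graph_Theory.Graph_Theory"
begin

(* Finite simple undirected graphs are the pair_graph instances of Graph_Theory: a finite vertex
   set with an irreflexive symmetric arc relation, each edge uv being the two arcs (u,v), (v,u).
   Hence the degree of a vertex is its out_degree. *)

definition path_graph :: "nat \<Rightarrow> nat pair_pre_digraph" where
  "path_graph n = \<lparr> pverts = {0..<n},
     parcs = {(i, j). i < n \<and> j < n \<and> (j = i + 1 \<or> i = j + 1)} \<rparr>"

(* The cycle on n vertices, intended for n \<ge> 3. *)
definition cycle_graph :: "nat \<Rightarrow> nat pair_pre_digraph" where
  "cycle_graph n = \<lparr> pverts = {0..<n},
     parcs = {(i, j). i < n \<and> j < n \<and> (j = (i + 1) mod n \<or> i = (j + 1) mod n)} \<rparr>"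

definition closed_neighborhood :: "('a, 'b) pre_digraph \<Rightarrow> 'a set \<Rightarrow> 'a set" where
  "closed_neighborhood G D = D \<union> {v \<in> verts G. \<exists>u\<in>D. u \<rightarrow>\<^bsub>G\<^esub> v}"

(* Inserting 0 makes the maximum degree of the graph without vertices 0; it has no effect on
   any other finite graph. *)
definition max_degree :: "('a, 'b) pre_digraph \<Rightarrow> nat" where
  "max_degree G = Max (insert 0 (out_degree G ` verts G))"

definition one_isolating :: "('a, 'b) pre_digraph \<Rightarrow> 'a set \<Rightarrow> bool" where
  "one_isolating G D \<longleftrightarrow>
     D \<subseteq> verts G \<and> max_degree (G \<restriction> (verts G - closed_neighborhood G D)) \<le> 1"

(* The minimum exists for every finite G, since D = verts G is 1-isolating. *)
definition one_isolation_number :: "('a, 'b) pre_digraph \<Rightarrow> nat" where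
  "one_isolation_number G = (LEAST k. \<exists>D. one_isolating G D \<and> card D = k)"

(* In a symmetric digraph the library's cycle also admits u, v, u (length 2); for lengths m \<ge> 3
   its cycles are exactly the cycles of the undirected graph. They need not be induced. *)
definition contains_cycle_of_length :: "('a, 'b) pre_digraph \<Rightarrow> nat \<Rightarrow> bool" where
  "contains_cycle_of_length G m \<longleftrightarrow> (\<exists>p. pre_digraph.cycle G p \<and> length p = m)"

end

theory Submission
  imports Defs
begin

text \<open>
  The graphs \<open>P\<^sub>3\<close>, \<open>C\<^sub>3\<close>, \<open>C\<^sub>7\<close>, \<open>C\<^sub>1\<^sub>1\<close> are called exceptional. For each of them the isolation
  number of \<open>H\<close> is \<open>(|H| + 1) / 4\<close>, but it drops to \<open>(|H| - 3) / 4\<close> as soon as one vertex of \<open>H\<close> is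
  removed. Hence, in a minimal counterexample, whenever \<open>D \<subseteq> Y\<close> takes care of \<open>Y\<close>, the number
  \<open>k\<close> of exceptional components of \<open>G - Y\<close>, of which \<open>t\<close> meet the closed neighbourhood of \<open>D\<close>,
  satisfies \<open>|Y| + 1 + 4 t \<le> 4 |D| + k\<close>.

  Let \<open>v\<close> have degree at least 3. Choosing \<open>D = {v}\<close>, \<open>D = {x}\<close>, \<open>D = N(v)\<close> and \<open>D = {x, v}\<close>
  in this inequality shows that \<open>G - N[v]\<close> has an exceptional component \<open>H\<close>, that each such
  component is adjacent to at least two vertices of \<open>N(v)\<close>, and that no
  \<open>x \<in> N(v)\<close> is adjacent to two of them.
  Two distinct vertices of \<open>N(v)\<close> are never adjacent to the two ends of a path on three vertices in
  \<open>H\<close>, as \<open>G\<close> has no 6-cycle. Together with \<open>D = {y}\<close> for suitable \<open>y \<in> H\<close> this leaves one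
  configuration, in which \<open>v\<close> has degree 3 and lies in a second exceptional piece \<open>K\<close>, and which is
  excluded by one more choice of \<open>D\<close>. So the maximum degree is at most 2, and \<open>G\<close> is a path or a
  cycle, where it suffices to take roughly every fifth vertex.
\<close>

section \<open>Graphs as symmetric irreflexive relations, with connectivity expressed by closed
  sets\<close>

locale simple_rel =
  fixes E :: "'a \<Rightarrow> 'a \<Rightarrow> bool"
  assumes E_sym: "E x y \<Longrightarrow> E y x"
    and E_irrefl: "\<not> E x x"
begin

text \<open>Neighbours range over the whole type, so that one set serves every induced subgraph
  \<open>S\<close> through \<open>S - closed_nbhd D\<close>.\<close>

definition closed_nbhd :: "'a set \<Rightarrow> 'a set" where
  "closed_nbhd D = D \<union> {w. \<exists>u\<in>D. E u w}"

text \<open>Maximum degree at most one in the graph induced on \<open>L\<close>, phrased without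
  cardinalities.\<close>

definition sparse :: "'a set \<Rightarrow> bool" where
  "sparse L \<longleftrightarrow> (\<forall>u\<in>L. \<forall>w\<in>L. \<forall>w'\<in>L. E u w \<longrightarrow> E u w' \<longrightarrow> w = w')"

definition isolates :: "'a set \<Rightarrow> 'a set \<Rightarrow> bool" where
  "isolates S D \<longleftrightarrow> D \<subseteq> S \<and> sparse (S - closed_nbhd D)"

text \<open>The closed sets are the unions of components of the graph induced on \<open>S\<close>.
  Connectivity is defined through them, which avoids walks.\<close>

definition closed_in :: "'a set \<Rightarrow> 'a set \<Rightarrow> bool" where
  "closed_in S A \<longleftrightarrow> A \<subseteq> S \<and> (\<forall>a\<in>A. \<forall>b\<in>S - A. \<not> E a b)"

definition connected_set :: "'a set \<Rightarrow> bool" where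
  "connected_set S \<longleftrightarrow> S \<noteq> {} \<and> (\<forall>A. closed_in S A \<longrightarrow> A \<noteq> {} \<longrightarrow> A = S)"

definition components :: "'a set \<Rightarrow> 'a set set" where
  "components S = {C. closed_in S C \<and> connected_set C}"

text \<open>Indexing a cycle periodically by the integers makes its rotations and reflections mere
  substitutions \<open>i + k\<close> and \<open>- i\<close> for the index.\<close>

definition cycle_on :: "int \<Rightarrow> (int \<Rightarrow> 'a) \<Rightarrow> 'a set \<Rightarrow> bool" where
  "cycle_on m c S \<longleftrightarrow> S = c ` {0..<m} \<and> (\<forall>i j. c i = c j \<longleftrightarrow> m dvd i - j) \<and>
     (\<forall>i j. E (c i) (c j) \<longleftrightarrow> m dvd i - j - 1 \<or> m dvd i - j + 1)"

text \<open>A connected set of three vertices induces \<open>P\<^sub>3\<close> or \<open>C\<^sub>3\<close>.\<close>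

definition exceptional :: "'a set \<Rightarrow> bool" where
  "exceptional S \<longleftrightarrow> connected_set S \<and> card S = 3 \<or> (\<exists>m c. (m = 7 \<or> m = 11) \<and> cycle_on m c S)"

definition has_C6 :: "'a set \<Rightarrow> bool" where
  "has_C6 S \<longleftrightarrow> (\<exists>a b c d e f. {a, b, c, d, e, f} \<subseteq> S \<and> distinct [a, b, c, d, e, f] \<and>
     E a b \<and> E b c \<and> E c d \<and> E d e \<and> E e f \<and> E f a)"

lemma sparse_subset: "sparse L \<Longrightarrow> L' \<subseteq> L \<Longrightarrow> sparse L'"
  unfolding sparse_def by (meson subsetD)

lemma closed_nbhd_mono: "D \<subseteq> D' \<Longrightarrow> closed_nbhd D \<subseteq> closed_nbhd D'"
  unfolding closed_nbhd_def by blast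

lemma sparse_card_le_2:
  assumes "finite L" "card L \<le> 2"
  shows "sparse L"
  unfolding sparse_def
proof (intro ballI impI)
  fix u w w' assume *: "u \<in> L" "w \<in> L" "w' \<in> L" "E u w" "E u w'"
  show "w = w'"
  proof (rule ccontr)
    assume "w \<noteq> w'"
    moreover have "u \<noteq> w" "u \<noteq> w'" using * E_irrefl by metis+
    ultimately have "card {u, w, w'} = 3" by simp
    moreover have "card {u, w, w'} \<le> card L" using * assms(1) by (intro card_mono) auto
    ultimately show False using assms(2) by simp
  qed
qed

lemma closed_in_Inter: "\<A> \<noteq> {} \<Longrightarrow> \<forall>A\<in>\<A>. closed_in S A \<Longrightarrow> closed_in S (\<Inter>\<A>)"
  unfolding closed_in_def by blast

lemma closed_in_Diff: "closed_in S A \<Longrightarrow> closed_in S (S - A)"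
  unfolding closed_in_def using E_sym by blast

lemma closed_in_restrict: "closed_in S A \<Longrightarrow> B \<subseteq> S \<Longrightarrow> closed_in B (A \<inter> B)"
  unfolding closed_in_def by blast

lemma closed_in_trans: "closed_in S A \<Longrightarrow> closed_in A B \<Longrightarrow> closed_in S B"
  unfolding closed_in_def by blast

lemma closed_in_D: "closed_in S A \<Longrightarrow> a \<in> A \<Longrightarrow> E a b \<Longrightarrow> b \<in> S \<Longrightarrow> b \<in> A"
  unfolding closed_in_def by blast

text \<open>The intersection of \<open>A\<close> with \<open>C\<close> is closed in
  \<open>A\<close>. Through this fact a component absorbs every connected piece that it
  meets.\<close>

lemma connected_set_subset_closed_in:
  assumes "connected_set A" "A \<subseteq> S" "closed_in S C" "A \<inter> C \<noteq> {}"
  shows "A \<subseteq> C"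
proof -
  have "closed_in A (C \<inter> A)" using closed_in_restrict assms by blast
  then have "C \<inter> A = A" using assms unfolding connected_set_def by (metis inf_commute)
  then show ?thesis by blast
qed

lemma components_subset: "C \<in> components S \<Longrightarrow> C \<subseteq> S"
  unfolding components_def closed_in_def by blast

lemma components_disjoint: "C \<in> components S \<Longrightarrow> C' \<in> components S \<Longrightarrow> C \<inter> C' \<noteq> {} \<Longrightarrow> C = C'"
  using connected_set_subset_closed_in[of C S C'] connected_set_subset_closed_in[of C' S C]
  unfolding components_def closed_in_def by blast

text \<open>The component of \<open>u\<close> is the intersection of all closed sets containing
  \<open>u\<close>. A closed part of it missing \<open>u\<close> would have a closed complement that
  takes part in this intersection, so the part would be empty.\<close>

lemma comp_exists:
  assumes "u \<in> S"
  shows "\<exists>C\<in>components S. u \<in> C"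
proof -
  let ?A = "{A. closed_in S A \<and> u \<in> A}"
  let ?C = "\<Inter>?A"
  have "closed_in S S" unfolding closed_in_def by blast
  then have ne: "?A \<noteq> {}" using assms by blast
  then have c: "closed_in S ?C" by (intro closed_in_Inter) auto
  have "connected_set ?C"
    unfolding connected_set_def
  proof (intro conjI allI impI)
    show "?C \<noteq> {}" by blast
    fix B assume B: "closed_in ?C B" "B \<noteq> {}"
    then have BC: "B \<subseteq> ?C" unfolding closed_in_def by blast
    have clB: "closed_in S B" using closed_in_trans[OF c B(1)] .
    show "B = ?C"
    proof (cases "u \<in> B")
      case True
      then have "?C \<subseteq> B" using clB by blast
      then show ?thesis using BC by (rule equalityI[rotated])
    next
      case False
      then have "S - B \<in> ?A" using closed_in_Diff[OF clB] assms by blast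
      then have "?C \<subseteq> S - B" by (rule Inter_lower)
      then have "B \<subseteq> S - B" using BC by (rule subset_trans[rotated])
      then show ?thesis using B(2) by blast
    qed
  qed
  then have "?C \<in> components S" using c unfolding components_def by simp
  moreover have "u \<in> ?C" by simp
  ultimately show ?thesis by (rule bexI[rotated])
qed

lemma Union_components: "\<Union>(components S) = S"
  using comp_exists components_subset by blast

lemma finite_components: "finite S \<Longrightarrow> finite (components S)"
  by (rule finite_subset[of _ "Pow S"]) (use components_subset in auto)

lemma card_components: "finite S \<Longrightarrow> card S = (\<Sum>C\<in>components S. card C)"
proof -
  assume f: "finite S"
  have "card (\<Union>(components S)) = (\<Sum>C\<in>components S. card C)"
  proof (rule card_Union_disjoint)
    show "pairwise disjnt (components S)" using components_disjoint
        unfolding pairwise_def disjnt_def by blast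
    show "finite A" if "A \<in> components S" for A using that f components_subset finite_subset
        by blast
  qed
  then show ?thesis by (simp add: Union_components)
qed

section \<open>Periodically indexed cycles\<close>

lemma cycle_on_rotate: "cycle_on m c S \<Longrightarrow> m > 0 \<Longrightarrow> cycle_on m (\<lambda>i. c (i + k)) S"
proof -
  assume c: "cycle_on m c S" and m: "m > 0"
  have "c ` {0..<m} = (\<lambda>i. c (i + k)) ` {0..<m}"
  proof -
    have "c i \<in> c ` {0..<m}" for i
    proof -
      have "c i = c (i mod m)" using c unfolding cycle_on_def
          by (simp add: mod_eq_dvd_iff[symmetric])
      then show ?thesis using m by auto
    qed
    moreover have "c i \<in> (\<lambda>i. c (i + k)) ` {0..<m}" for i
    proof -
      have "c i = c ((i - k) mod m + k)"
        using c unfolding cycle_on_def by (simp add: mod_eq_dvd_iff[symmetric]) (metis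
            diff_add_cancel mod_add_left_eq)
      then show ?thesis using m by auto
    qed
    ultimately show ?thesis by auto
  qed
  then show ?thesis using c unfolding cycle_on_def by (simp add: algebra_simps)
qed

lemma cycle_on_in: "cycle_on m c S \<Longrightarrow> m > 0 \<Longrightarrow> c i \<in> S"
proof -
  assume c: "cycle_on m c S" and m: "m > 0"
  have "c i = c (i mod m)" using c unfolding cycle_on_def by (simp add: mod_eq_dvd_iff[symmetric])
  moreover have "i mod m \<in> {0..<m}" using m by simp
  ultimately show ?thesis using c unfolding cycle_on_def by blast
qed

lemma cycle_on_reflect: "cycle_on m c S \<Longrightarrow> m > 0 \<Longrightarrow> cycle_on m (\<lambda>i. c (- i)) S"
proof -
  assume c: "cycle_on m c S" and m: "m > 0"
  have "c ` {0..<m} = (\<lambda>i. c (- i)) ` {0..<m}"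
  proof -
    have "c (-i) \<in> c ` {0..<m}" for i
      using cycle_on_in[OF c m] c unfolding cycle_on_def by auto
    moreover have "c i \<in> (\<lambda>i. c (- i)) ` {0..<m}" for i
    proof -
      have "c i = c (- ((- i) mod m))"
        using c unfolding cycle_on_def by (simp add: mod_eq_dvd_iff[symmetric]) (metis
            add.inverse_inverse mod_minus_eq)
      then show ?thesis using m by auto
    qed
    ultimately show ?thesis by auto
  qed
  moreover have "m dvd j - i \<longleftrightarrow> m dvd i - j" "m dvd j - i - 1 \<longleftrightarrow> m dvd i - j + 1" "m dvd j - i + 1
      \<longleftrightarrow> m dvd i - j - 1" for i j
    by (metis dvd_minus_iff minus_diff_eq, smt (verit) dvd_minus_iff, smt (verit) dvd_minus_iff)
  ultimately show ?thesis using c unfolding cycle_on_def by (auto simp: algebra_simps)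
qed

lemma cycle_on_root:
  assumes "cycle_on m c S" "m > 0" "y \<in> S"
  obtains c' where "cycle_on m c' S" "c' 0 = y"
proof -
  obtain k where "y = c k" using assms unfolding cycle_on_def by auto
  then show ?thesis using that[OF cycle_on_rotate[OF assms(1,2), of k]] by simp
qed

lemma cycle_on_nbrs:
  assumes "cycle_on m c S" "m > 0" "E (c i) z" "z \<in> S"
  shows "z = c (i + 1) \<or> z = c (i - 1)"
proof -
  obtain k where k: "z = c k" using assms unfolding cycle_on_def by auto
  then have "m dvd i - k - 1 \<or> m dvd i - k + 1" using assms unfolding cycle_on_def by metis
  then have "c (i - 1) = c k \<or> c (i + 1) = c k" using assms(1) unfolding cycle_on_def
    by (simp add: algebra_simps)
  then show ?thesis using k by auto
qed

text \<open>Rotation puts \<open>y\<close> at index 0. If \<open>z\<close> then sits at index -1, a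
  reflection moves it to 1.\<close>

lemma cycle_on_root_edge:
  assumes "cycle_on m c S" "m > 0" "y \<in> S" "z \<in> S" "E y z"
  obtains c' where "cycle_on m c' S" "c' 0 = y" "c' 1 = z"
proof -
  obtain c1 where c1: "cycle_on m c1 S" "c1 0 = y" using cycle_on_root assms by metis
  then have "z = c1 1 \<or> z = c1 (-1)" using cycle_on_nbrs[OF c1(1) assms(2), of 0 z] assms by simp
  then show ?thesis
  proof
    assume "z = c1 1" then show ?thesis using that c1 by blast
  next
    assume "z = c1 (-1)" then show ?thesis using that[OF cycle_on_reflect[OF c1(1) assms(2)]] c1
        by simp
  qed
qed

lemma cycle_on_card: "cycle_on m c S \<Longrightarrow> card S = nat m"
proof -
  assume c: "cycle_on m c S"
  have "inj_on c {0..<m}"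
  proof (rule inj_onI)
    fix i j assume ij: "i \<in> {0..<m}" "j \<in> {0..<m}" "c i = c j"
    then have "m dvd i - j" using c unfolding cycle_on_def by blast
    then have "i mod m = j mod m" by (simp add: mod_eq_dvd_iff)
    then show "i = j" using ij by simp
  qed
  then show ?thesis using c unfolding cycle_on_def by (simp add: card_image)
qed

lemma cycle_on_finite: "cycle_on m c S \<Longrightarrow> finite S"
  unfolding cycle_on_def by simp

section \<open>Exceptional sets and the effect of deleting vertices\<close>

lemma exceptional_finite: "exceptional S \<Longrightarrow> finite S"
  unfolding exceptional_def using cycle_on_finite card_ge_0_finite[of S] by auto

lemma exceptional_card: "exceptional S \<Longrightarrow> card S \<in> {3, 7, 11}"
  unfolding exceptional_def using cycle_on_card by fastforce

text \<open>Membership in a nonempty closed set spreads upwards and downwards from any index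
  \<open>k\<close> in it. The lemma serves both whole cycles and the paths left after deleting a
  closed neighbourhood.\<close>

lemma connected_set_path:
  fixes c :: "int \<Rightarrow> 'a"
  assumes "\<And>i. l \<le> i \<Longrightarrow> i < h \<Longrightarrow> E (c i) (c (i + 1))" "l \<le> h"
  shows "connected_set (c ` {l..h})"
  unfolding connected_set_def
proof (intro conjI allI impI)
  show "c ` {l..h} \<noteq> {}" using assms(2) by auto
  fix A assume A: "closed_in (c ` {l..h}) A" "A \<noteq> {}"
  then obtain k where k: "k \<in> {l..h}" "c k \<in> A" unfolding closed_in_def by blast
  have up: "c i \<in> A" if "k \<le> i" "i \<le> h" for i
    using that
  proof (induction i rule: int_ge_induct)
    case base then show ?case using k by simp
  next
    case (step i)
    have "E (c i) (c (i + 1))" using step k by (intro assms(1)) auto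
    moreover have "c (i + 1) \<in> c ` {l..h}" "c i \<in> A" using step k by auto
    ultimately show ?case using closed_in_D[OF A(1)] by blast
  qed
  have down: "c i \<in> A" if "i \<le> k" "l \<le> i" for i
    using that
  proof (induction i rule: int_le_induct)
    case base then show ?case using k by simp
  next
    case (step i)
    have "E (c (i - 1)) (c i)" using assms(1)[of "i - 1"] step k by auto
    moreover have "c (i - 1) \<in> c ` {l..h}" "c i \<in> A" using step k by auto
    ultimately show ?case using closed_in_D[OF A(1)] E_sym by blast
  qed
  show "A = c ` {l..h}"
  proof
    show "A \<subseteq> c ` {l..h}" using A(1) unfolding closed_in_def by blast
    have "c i \<in> A" if "i \<in> {l..h}" for i
      using that up[of i] down[of i] by (cases "k \<le> i") auto
    then show "c ` {l..h} \<subseteq> A" by blast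
  qed
qed

lemma exceptional_connected_set: "exceptional S \<Longrightarrow> connected_set S"
proof -
  assume e: "exceptional S"
  have "connected_set S" if "cycle_on m c S" "m = 7 \<or> m = 11" for m c
  proof -
    have "S = c ` {0..m - 1}" using that unfolding cycle_on_def by auto
    moreover have "connected_set (c ` {0..m - 1})"
      using that by (intro connected_set_path) (auto simp: cycle_on_def)
    ultimately show ?thesis by simp
  qed
  then show ?thesis using e unfolding exceptional_def by blast
qed

text \<open>Without \<open>c 0\<close> the cycle is a path. Dominating the triple around
  \<open>c 3\<close>, and for length 11 also that around \<open>c 8\<close>, leaves the edge from
  \<open>c 5\<close> to \<open>c 6\<close> and the isolated vertices \<open>c 1\<close> and, for
  length 11, \<open>c 10\<close>. That \<open>c 1\<close> ends up isolated is what later permits one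
  extra edge at it.\<close>

lemma exceptional_delete_cycle:
  assumes c: "cycle_on m c S" and m: "m = 7 \<or> m = 11"
  obtains D where "D \<subseteq> S - {c 0}" "4 * card D + 3 = card S" "sparse (S - {c 0} - closed_nbhd D)"
    "\<forall>w\<in>S - {c 0} - closed_nbhd D. \<not> E (c 1) w"
proof -
  define D where "D = (if m = 7 then {c 3} else {c 3, c 8})"
  have eq: "c i = c j \<longleftrightarrow> m dvd i - j" for i j using c unfolding cycle_on_def by blast
  have Eq: "E (c i) (c j) \<longleftrightarrow> m dvd i - j - 1 \<or> m dvd i - j + 1" for i j using c
      unfolding cycle_on_def by blast
  have S: "S = c ` {0..<m}" using c unfolding cycle_on_def by blast
  have card: "4 * card D + 3 = card S"
    using m cycle_on_card[OF c] by (auto simp: D_def eq)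
  have sub: "D \<subseteq> S - {c 0}" using m by (auto simp: D_def eq S)
  have left: "S - {c 0} - closed_nbhd D \<subseteq> c ` ({1, 5, 6} \<union> (if m = 7 then {} else {10}))"
  proof
    fix u assume u: "u \<in> S - {c 0} - closed_nbhd D"
    then obtain i where i: "u = c i" "0 \<le> i" "i < m" using S by auto
    have "u \<noteq> c 0" "u \<notin> closed_nbhd D" using u by auto
    from m show "u \<in> c ` ({1, 5, 6} \<union> (if m = 7 then {} else {10}))"
    proof
      assume m: "m = 7"
      then have "i = 0 \<or> i = 1 \<or> i = 2 \<or> i = 3 \<or> i = 4 \<or> i = 5 \<or> i = 6"
        using i by presburger
      then show ?thesis using \<open>u \<noteq> c 0\<close> \<open>u \<notin> closed_nbhd D\<close> i(1) m
          by (auto simp: D_def closed_nbhd_def Eq)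
    next
      assume m: "m = 11"
      then have "i = 0 \<or> i = 1 \<or> i = 2 \<or> i = 3 \<or> i = 4 \<or> i = 5 \<or> i = 6 \<or> i = 7 \<or> i = 8 \<or> i = 9
          \<or> i = 10"
        using i by presburger
      then show ?thesis using \<open>u \<noteq> c 0\<close> \<open>u \<notin> closed_nbhd D\<close> i(1) m
          by (auto simp: D_def closed_nbhd_def Eq)
    qed
  qed
  have sp: "sparse (c ` ({1, 5, 6} \<union> (if m = 7 then {} else {10})))"
    using m unfolding sparse_def by (auto simp: Eq)
  have "\<forall>w\<in>c ` ({1, 5, 6} \<union> (if m = 7 then {} else {10})). \<not> E (c 1) w"
    using m by (auto simp: Eq)
  then show ?thesis using that[OF sub card sparse_subset[OF sp left]] left by blast
qed

text \<open>Deleting one vertex saves exactly one element compared with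
  \<open>exceptional_iso\<close>. For three vertices the empty set works, because only two
  remain.\<close>

lemma exceptional_delete:
  assumes "exceptional S" "y \<in> S"
  obtains D where "D \<subseteq> S - {y}" "4 * card D + 3 = card S" "sparse (S - {y} - closed_nbhd D)"
proof -
  consider "card S = 3" | m c where "m = 7 \<or> m = 11" "cycle_on m c S" using assms
      unfolding exceptional_def by blast
  then show ?thesis
  proof cases
    case 1
    then have "sparse (S - {y} - closed_nbhd {})"
      using assms exceptional_finite by (intro sparse_card_le_2) (auto simp: closed_nbhd_def)
    then show ?thesis using that[of "{}"] 1 by simp
  next
    case 2
    then have "m > 0" by auto
    obtain c' where c': "cycle_on m c' S" "c' 0 = y" using cycle_on_root[OF 2(2) \<open>m > 0\<close> assms(2)] .
    show ?thesis using exceptional_delete_cycle[OF c'(1) 2(1)] that c'(2) by metis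
  qed
qed

text \<open>On a cycle the neighbour \<open>z\<close> of \<open>y\<close> can be given index 1. For
  three vertices the last assumption excludes the triangle and the path with middle
  \<open>z\<close>, so that \<open>z\<close> is isolated once \<open>y\<close> is gone.\<close>

lemma exceptional_delete_edge:
  assumes "exceptional S" "y \<in> S" "z \<in> S" "E y z" "card S = 3 \<Longrightarrow> \<forall>w\<in>S. E z w \<longrightarrow> w = y"
  obtains D where "D \<subseteq> S - {y}" "4 * card D + 3 = card S" "sparse (S - {y} - closed_nbhd D)"
    "\<forall>w\<in>S - {y} - closed_nbhd D. \<not> E z w"
proof -
  consider "card S = 3" | m c where "m = 7 \<or> m = 11" "cycle_on m c S" using assms
      unfolding exceptional_def by blast
  then show ?thesis
  proof cases
    case 1
    then show ?thesis using exceptional_delete[OF assms(1,2)] assms(5) that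
        by (metis DiffD1 DiffD2 singletonI)
  next
    case 2
    then have "m > 0" by auto
    obtain c' where c': "cycle_on m c' S" "c' 0 = y" "c' 1 = z"
      using cycle_on_root_edge[OF 2(2) \<open>m > 0\<close> assms(2-4)] .
    show ?thesis using exceptional_delete_cycle[OF c'(1) 2(1)] that c'(2,3) by metis
  qed
qed

text \<open>The deleted vertex \<open>y\<close> is added to the set from
  \<open>exceptional_delete\<close>.\<close>

lemma exceptional_iso:
  assumes "exceptional S"
  obtains D where "isolates S D" "4 * card D = card S + 1"
proof -
  obtain y where y: "y \<in> S" using assms exceptional_connected_set unfolding connected_set_def
      by blast
  obtain D where D: "D \<subseteq> S - {y}" "4 * card D + 3 = card S" "sparse (S - {y} - closed_nbhd D)"
    using exceptional_delete[OF assms y] .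
  have "finite D" using D exceptional_finite[OF assms] by (meson finite_Diff finite_subset)
  then have "card (insert y D) = card D + 1" using D by (subst card_insert_disjoint) auto
  moreover have "S - closed_nbhd (insert y D) \<subseteq> S - {y} - closed_nbhd D" unfolding closed_nbhd_def
      by auto
  then have "isolates S (insert y D)" using D y sparse_subset unfolding isolates_def by blast
  ultimately show ?thesis using that D by fastforce
qed

lemma exceptional_degree:
  assumes "exceptional S" "u \<in> S"
  shows "card {w\<in>S. E u w} \<le> 2"
proof -
  consider "card S = 3" | m c where "m = 7 \<or> m = 11" "cycle_on m c S" using assms
      unfolding exceptional_def by blast
  then show ?thesis
  proof cases
    case 1
    have "card {w\<in>S. E u w} \<le> card (S - {u})"
      using assms exceptional_finite E_irrefl by (intro card_mono) auto
    then show ?thesis using 1 assms exceptional_finite by simp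
  next
    case 2
    then have "m > 0" by auto
    obtain c' where c': "cycle_on m c' S" "c' 0 = u" using cycle_on_root[OF 2(2) \<open>m > 0\<close> assms(2)] .
    have "{w\<in>S. E u w} \<subseteq> {c' 1, c' (-1)}"
      using cycle_on_nbrs[OF c'(1) \<open>m > 0\<close>, of 0] c'(2) by auto
    then have "card {w\<in>S. E u w} \<le> card {c' 1, c' (-1)}" by (intro card_mono) auto
    also have "\<dots> \<le> 2" by (simp add: card_insert_le_m1)
    finally show ?thesis .
  qed
qed

lemma exceptional_cases:
  assumes "exceptional S"
  obtains "card S = 3" | m c where "m = 7 \<or> m = 11" "cycle_on m c S"
  using assms unfolding exceptional_def by blast

lemma cycle_on_two_nbrs:
  assumes c: "cycle_on m c S" and m: "m = 7 \<or> m = 11" and u: "u \<in> S"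
  obtains a b where "{w\<in>S. E u w} = {a, b}" "a \<noteq> b" "\<not> E a b"
proof -
  have m0: "m > 0" using m by auto
  obtain c' where c': "cycle_on m c' S" "c' 0 = u" using cycle_on_root[OF c m0 u] .
  have "{w\<in>S. E u w} = {c' 1, c' (-1)}"
  proof
    show "{w\<in>S. E u w} \<subseteq> {c' 1, c' (-1)}"
      using cycle_on_nbrs[OF c'(1) m0, of 0] c'(2) by auto
    have "E (c' 0) (c' 1)" "E (c' 0) (c' (-1))" using c'(1) unfolding cycle_on_def by auto
    then show "{c' 1, c' (-1)} \<subseteq> {w\<in>S. E u w}"
      using cycle_on_in[OF c'(1) m0] c'(2) by auto
  qed
  moreover have "c' 1 \<noteq> c' (-1)" "\<not> E (c' 1) (c' (-1))" using c'(1) m unfolding cycle_on_def by auto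
  ultimately show ?thesis using that by blast
qed

text \<open>With \<open>a\<close>, \<open>u\<close>, \<open>b\<close> at indices 0, 1, 2, the vertex
  \<open>w\<close> is at 1 or -1 and also at 1 or 3. Indices -1 and 3 differ, because neither 7 nor
  11 divides 4.\<close>

lemma cycle_on_no_C4:
  assumes c: "cycle_on m c S" and m: "m = 7 \<or> m = 11" and S: "u \<in> S" "w \<in> S" "a \<in> S" "b \<in> S"
    and e: "E u a" "E u b" "a \<noteq> b" "E w a" "E w b"
  shows "u = w"
proof -
  have m0: "m > 0" using m by auto
  obtain c' where c': "cycle_on m c' S" "c' 0 = a" "c' 1 = u"
    using cycle_on_root_edge[OF c m0 S(3,1)] e E_sym by metis
  have eq: "c' i = c' j \<longleftrightarrow> m dvd i - j" for i j using c' unfolding cycle_on_def by blast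
  have b: "b = c' 2" using cycle_on_nbrs[OF c'(1) m0, of 1 b] c'(2,3) S e by auto
  have "w = c' 1 \<or> w = c' (-1)" using cycle_on_nbrs[OF c'(1) m0, of 0 w] c'(2) S e E_sym by auto
  moreover have "w = c' 1 \<or> w = c' 3" using cycle_on_nbrs[OF c'(1) m0, of 2 w] b S e E_sym by auto
  moreover have "c' (-1) \<noteq> c' 3" using m by (auto simp: eq)
  ultimately show ?thesis using c'(3) by auto
qed

text \<open>What remains is a path on \<open>m - 3\<close> vertices. The point is that its order 4
  or 8 is never the order of an exceptional set.\<close>

lemma cycle_on_remainder:
  assumes c: "cycle_on m c S" and m: "m = 7 \<or> m = 11" and y: "y \<in> S"
  shows "connected_set (S - closed_nbhd {y})" "card (S - closed_nbhd {y}) \<in> {4, 8}"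
proof -
  have m0: "m > 0" using assms by auto
  obtain c' where c': "cycle_on m c' S" "c' 0 = y" using cycle_on_root[OF c m0 y] .
  have eq: "c' i = c' j \<longleftrightarrow> m dvd i - j" for i j using c' unfolding cycle_on_def by blast
  have Eq: "E (c' i) (c' j) \<longleftrightarrow> m dvd i - j - 1 \<or> m dvd i - j + 1" for i j using c'
      unfolding cycle_on_def by blast
  have S: "S = c' ` {0..<m}" using c' unfolding cycle_on_def by blast
  have d: "S - closed_nbhd {y} = S - {c' 0, c' 1, c' (m - 1)}"
  proof -
    have "c' (-1) = c' (m - 1)" by (simp add: eq)
    then have "S \<inter> closed_nbhd {y} = {c' 0, c' 1, c' (m - 1)}"
      using cycle_on_nbrs[OF c'(1) m0, of 0] cycle_on_in[OF c'(1) m0] c'(2)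
          unfolding closed_nbhd_def
      by (auto simp: Eq)
    then show ?thesis by blast
  qed
  have inj: "c' i = c' j \<longleftrightarrow> i = j" if "0 \<le> i" "i < m" "0 \<le> j" "j < m" for i j
    unfolding eq using that by (metis mod_eq_dvd_iff mod_pos_pos_trivial)
  have p: "S - closed_nbhd {y} = c' ` {2..m - 2}"
  proof
    show "S - closed_nbhd {y} \<subseteq> c' ` {2..m - 2}"
    proof
      fix u assume "u \<in> S - closed_nbhd {y}"
      then have u: "u \<in> S" "u \<noteq> c' 0" "u \<noteq> c' 1" "u \<noteq> c' (m - 1)" unfolding d by simp_all
      then obtain i where i: "u = c' i" "i \<in> {0..<m}" unfolding S by (elim imageE)
      then have "i \<noteq> 0" "i \<noteq> 1" "i \<noteq> m - 1" using u(2-4) by metis+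
      then have "i \<in> {2..m - 2}" using i(2) by simp
      then show "u \<in> c' ` {2..m - 2}" using i(1) by simp
    qed
    show "c' ` {2..m - 2} \<subseteq> S - closed_nbhd {y}"
    proof (rule image_subsetI)
      fix i assume "i \<in> {2..m - 2}"
      then have i: "2 \<le> i" "i < m" "i \<noteq> m - 1" by auto
      then have "c' i \<noteq> c' 0" "c' i \<noteq> c' 1" "c' i \<noteq> c' (m - 1)"
        using inj[of i 0] inj[of i 1] inj[of i "m - 1"] m by auto
      then show "c' i \<in> S - closed_nbhd {y}" unfolding d using cycle_on_in[OF c'(1) m0] by simp
    qed
  qed
  show "connected_set (S - closed_nbhd {y})"
    unfolding p using m by (intro connected_set_path) (auto simp: Eq)
  have "inj_on c' {2..m - 2}"
  proof (rule inj_onI)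
    fix i j assume ij: "i \<in> {2..m - 2}" "j \<in> {2..m - 2}" "c' i = c' j"
    then have "0 \<le> i" "i < m" "0 \<le> j" "j < m" by simp_all
    then show "i = j" using inj ij(3) by blast
  qed
  then have "card (S - closed_nbhd {y}) = card {2..m - 2}" unfolding p by (rule card_image)
  then have "card (S - closed_nbhd {y}) = nat (m - 3)" by simp
  then show "card (S - closed_nbhd {y}) \<in> {4, 8}" using m by auto
qed

end

subsection \<open>A minimal counterexample\<close>

text \<open>The assumption \<open>smaller\<close> is the induction hypothesis. It carries no
  condition on 6-cycles, since every subset of \<open>V\<close> inherits their absence.\<close>

locale minimal_counterexample = simple_rel E for E :: "'a \<Rightarrow> 'a \<Rightarrow> bool" +
  fixes V :: "'a set"
  assumes fin: "finite V" and connected_set_V: "connected_set V" and no_C6: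
      "\<not> has_C6 V" and not_exceptional: "\<not> exceptional V"
    and smaller: "\<And>S. S \<subset> V \<Longrightarrow> connected_set S \<Longrightarrow> \<not> exceptional S \<Longrightarrow> \<exists>D. isolates S D
        \<and> 4 * card D \<le> card S"
    and cex: "\<And>D. isolates V D \<Longrightarrow> card V < 4 * card D"
begin

definition nbs :: "'a \<Rightarrow> 'a set" where
  "nbs v = {w\<in>V. E v w}"

definition exc_components :: "'a set \<Rightarrow> 'a set set" where
  "exc_components Y = {C\<in>components (V - Y). exceptional C}"

lemma finite_subset_V: "A \<subseteq> V \<Longrightarrow> finite A"
  using fin finite_subset by blast

lemma finite_nbs [simp]: "finite (nbs v)"
  using fin unfolding nbs_def by simp

lemma nbs_iff: "w \<in> nbs v \<longleftrightarrow> w \<in> V \<and> E v w"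
  unfolding nbs_def by blast

lemma not_in_nbs [simp]: "v \<notin> nbs v"
  using E_irrefl unfolding nbs_def by blast

lemma finite_exc_components [simp]: "finite (exc_components Y)"
  using finite_components[of "V - Y"] fin unfolding exc_components_def by simp

lemma exc_components_D:
  assumes "C \<in> exc_components Y"
  shows "closed_in (V - Y) C" "connected_set C" "exceptional C" "C \<subseteq> V - Y" "C \<noteq> {}"
  using assms unfolding exc_components_def components_def connected_set_def closed_in_def by blast+

lemma exc_components_I: "closed_in (V - Y) C \<Longrightarrow> exceptional C \<Longrightarrow> C \<in> exc_components Y"
  using exceptional_connected_set unfolding exc_components_def components_def by blast

lemma exc_components_disjoint: "C \<in> exc_components Y \<Longrightarrow> C' \<in> exc_components Y \<Longrightarrow> C \<inter> C' \<noteq> {} \<Longrightarrow> C = C'"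
  using components_disjoint unfolding exc_components_def by blast

text \<open>Without an edge to \<open>Y\<close> the component would be closed in the connected set
  \<open>V\<close>.\<close>

lemma exc_components_touch:
  assumes "C \<in> exc_components Y" "Y \<subseteq> V" "Y \<noteq> {}"
  obtains y u where "y \<in> Y" "u \<in> C" "E y u"
proof -
  have "\<not> closed_in V C"
    using connected_set_V exc_components_D(4,5)[OF assms(1)] assms(2,3) unfolding connected_set_def
        by blast
  then obtain u w where uw: "u \<in> C" "w \<in> V - C" "E u w"
    using exc_components_D(4)[OF assms(1)] unfolding closed_in_def by blast
  then have "w \<in> Y" using closed_in_D[OF exc_components_D(1)[OF assms(1)]] by blast
  then show ?thesis using that uw E_sym by blast
qed

text \<open>An exceptional component \<open>C\<close> costs \<open>(card C + 1) / 4\<close>, but only \<open>(card C - 3) / 4\<close> once \<open>D0\<close>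
  dominates one of its vertices; all other components cost at most a quarter of their size.\<close>

lemma reduce:
  assumes Y: "Y \<subseteq> V" "Y \<noteq> {}" and D0: "D0 \<subseteq> Y"
    and sp: "sparse (Y - closed_nbhd D0)"
    and free: "\<And>u w. u \<in> Y - closed_nbhd D0 \<Longrightarrow> w \<in> V - Y \<Longrightarrow> \<not> E u w"
  shows "card Y + 1 + 4 * card {C\<in>exc_components Y. C \<inter> closed_nbhd D0 \<noteq> {}} \<le> 4 * card D0 + card
      (exc_components Y)"
proof -
  define T where "T = {C\<in>exc_components Y. C \<inter> closed_nbhd D0 \<noteq> {}}"
  let ?K = "components (V - Y)"
  have fK: "finite ?K" using fin finite_components by blast
  have TX: "T \<subseteq> exc_components Y" "exc_components Y \<subseteq> ?K" unfolding T_def exc_components_def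
      by blast+
  \<comment> \<open>The conditional terms are the account of one component: an exceptional one may
    exceed its order by one unit, and being met by \<open>D0\<close> refunds four units, that is,
    one vertex.\<close>
  have "\<exists>D. D \<subseteq> C \<and> sparse (C - closed_nbhd (D0 \<union> D)) \<and>
      4 * card D + (if C \<in> T then 4 else 0) \<le> card C + (if C \<in> exc_components Y then 1 else 0)"
    if C: "C \<in> ?K" for C
  proof -
    have CV: "C \<subseteq> V - Y" using components_subset[OF C] .
    consider "C \<in> T" | "C \<in> exc_components Y" "C \<notin> T" | "C \<notin> exc_components Y" "C \<notin> T" using TX
        by blast
    then show ?thesis
    proof cases
      case 1
      then obtain y where y: "y \<in> C" "y \<in> closed_nbhd D0" "exceptional C"
          unfolding T_def exc_components_def by blast
      obtain D where D: "D \<subseteq> C - {y}" "4 * card D + 3 = card C" "sparse (C - {y} - closed_nbhd D)"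
        using exceptional_delete[OF y(3,1)] .
      have "C - closed_nbhd (D0 \<union> D) \<subseteq> C - {y} - closed_nbhd D" using y unfolding closed_nbhd_def
          by blast
      then show ?thesis using D 1 TX sparse_subset by (intro exI[of _ D]) auto
    next
      case 2
      then have "exceptional C" unfolding exc_components_def by blast
      then obtain D where D: "isolates C D" "4 * card D = card C + 1" using exceptional_iso by blast
      have "C - closed_nbhd (D0 \<union> D) \<subseteq> C - closed_nbhd D" unfolding closed_nbhd_def by blast
      then show ?thesis using D 2 sparse_subset unfolding isolates_def by (intro exI[of _ D]) auto
    next
      case 3
      then have "\<not> exceptional C" using C unfolding exc_components_def by blast
      moreover have "C \<subset> V" using CV Y by blast
      ultimately obtain D where D: "isolates C D" "4 * card D \<le> card C"
        using smaller C unfolding components_def by blast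
      have "C - closed_nbhd (D0 \<union> D) \<subseteq> C - closed_nbhd D" unfolding closed_nbhd_def by blast
      then show ?thesis using D 3 sparse_subset unfolding isolates_def by (intro exI[of _ D]) auto
    qed
  qed
  then obtain f where f: "\<And>C. C \<in> ?K \<Longrightarrow> f C \<subseteq> C" "\<And>C. C \<in> ?K \<Longrightarrow> sparse (C - closed_nbhd (D0 \<union> f C))"
    "\<And>C. C \<in> ?K \<Longrightarrow> 4 * card (f C) + (if C \<in> T then 4 else 0) \<le> card C + (if C \<in> exc_components Y then
        1 else 0)"
    by metis
  define D where "D = D0 \<union> (\<Union>C\<in>?K. f C)"
  have "f C \<subseteq> V" if "C \<in> ?K" for C using f(1)[OF that] components_subset[OF that] by blast
  then have DV: "D \<subseteq> V" using D0 Y unfolding D_def by blast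
  have cardD: "card D \<le> card D0 + (\<Sum>C\<in>?K. card (f C))"
    unfolding D_def using card_Un_le[of D0 "\<Union>C\<in>?K. f C"] card_UN_le[OF fK, of f] by linarith
  have "(\<Sum>C\<in>?K. 4 * card (f C) + (if C \<in> T then 4 else 0)) \<le> (\<Sum>C\<in>?K. card C + (if C \<in> exc_components
      Y then 1 else 0))"
    by (rule sum_mono) (use f(3) in blast)
  moreover have "(\<Sum>C\<in>?K. (if C \<in> T then 4 else 0)) = 4 * card T"
    using fK TX by (simp add: sum.If_cases Int_absorb1)
  moreover have "(\<Sum>C\<in>?K. (if C \<in> exc_components Y then 1 else 0)) = card (exc_components Y)"
    using fK TX by (simp add: sum.If_cases Int_absorb1)
  moreover have "(\<Sum>C\<in>?K. card C) = card (V - Y)"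
      by (rule card_components[symmetric]) (use fin in simp)
  ultimately have "4 * (\<Sum>C\<in>?K. card (f C)) + 4 * card T \<le> card (V - Y) + card (exc_components Y)"
    by (simp add: sum.distrib sum_distrib_left)
  moreover have "card V = card (V - Y) + card Y"
    using Y fin by (metis card_Diff_subset card_mono finite_subset le_add_diff_inverse2)
  moreover have "isolates V D"
    unfolding isolates_def sparse_def
  proof (intro conjI ballI impI)
    show "D \<subseteq> V" by fact
    fix u w w' assume u: "u \<in> V - closed_nbhd D" and w: "w \<in> V - closed_nbhd D"
        "w' \<in> V - closed_nbhd D" "E u w" "E u w'"
    have dD: "closed_nbhd D0 \<subseteq> closed_nbhd D" unfolding D_def by (intro closed_nbhd_mono) blast
    \<comment> \<open>The local choices do not interfere: an undominated vertex of \<open>Y\<close>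
      has its undominated neighbours in \<open>Y\<close> by \<open>free\<close>, and one outside
      \<open>Y\<close> has them in its own component.\<close>
    show "w = w'"
    proof (cases "u \<in> Y")
      case True
      then have "u \<in> Y - closed_nbhd D0" using u dD by blast
      moreover have "w \<in> Y - closed_nbhd D0" "w' \<in> Y - closed_nbhd D0"
          using free[OF \<open>u \<in> Y - closed_nbhd D0\<close>] w dD by blast+
      ultimately show ?thesis using sp w unfolding sparse_def by blast
    next
      case False
      then obtain C where C: "C \<in> ?K" "u \<in> C" using comp_exists u by (metis DiffD1 DiffI)
      have in_C: "z \<in> C" if "z \<in> V - closed_nbhd D" "E u z" for z
      proof -
        have "z \<notin> Y"
        proof
          assume "z \<in> Y"
          then have "z \<in> Y - closed_nbhd D0" using that dD by blast
          then show False using free[of z u] that(2) E_sym u False by blast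
        qed
        moreover have "closed_in (V - Y) C" using C(1) unfolding components_def by blast
        ultimately show ?thesis using closed_in_D[of "V - Y" C u z] C(2) that by blast
      qed
      have "closed_nbhd (D0 \<union> f C) \<subseteq> closed_nbhd D" unfolding D_def using C(1)
          by (intro closed_nbhd_mono) blast
      then have "u \<in> C - closed_nbhd (D0 \<union> f C)" "w \<in> C - closed_nbhd (D0 \<union> f C)"
          "w' \<in> C - closed_nbhd (D0 \<union> f C)"
        using in_C w u C(2) by blast+
      then show ?thesis using f(2)[OF C(1)] w unfolding sparse_def by blast
    qed
  qed
  then have "card V < 4 * card D" using cex by blast
  ultimately show ?thesis using cardD unfolding T_def by linarith
qed

lemma reduce_dom:
  assumes "Y \<subseteq> V" "Y \<noteq> {}" "D0 \<subseteq> Y" "Y \<subseteq> closed_nbhd D0"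
  shows "card Y + 1 + 4 * card {C\<in>exc_components Y. C \<inter> closed_nbhd D0 \<noteq> {}} \<le> 4 * card D0 + card
      (exc_components Y)"
proof -
  have "Y - closed_nbhd D0 = {}" using assms by blast
  then have "sparse (Y - closed_nbhd D0)" "\<And>u w. u \<in> Y - closed_nbhd D0 \<Longrightarrow> w \<in> V - Y \<Longrightarrow> \<not> E u w"
    unfolding sparse_def by blast+
  then show ?thesis by (rule reduce[OF assms(1-3)])
qed

section \<open>Exceptional components outside the closed neighbourhood of a vertex\<close>

definition far_exc :: "'a \<Rightarrow> 'a set set" where
  "far_exc v = exc_components (insert v (nbs v))"

definition attached :: "'a set \<Rightarrow> 'a \<Rightarrow> 'a set" where
  "attached H v = {x\<in>nbs v. \<exists>y\<in>H. E x y}"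

lemma far_exc_D:
  assumes "H \<in> far_exc v"
  shows "closed_in (V - insert v (nbs v)) H" "connected_set H" "exceptional H" "H \<subseteq> V" "v \<notin> H"
      "H \<inter> nbs v = {}" "H \<noteq> {}"
  using exc_components_D[of H "insert v (nbs v)"] assms unfolding far_exc_def by blast+

lemma far_exc_nbrs: "H \<in> far_exc v \<Longrightarrow> y \<in> H \<Longrightarrow> E y w \<Longrightarrow> w \<in> V \<Longrightarrow> w \<in> H \<or> w \<in> attached H v"
  using closed_in_D[OF far_exc_D(1), of H v y w] E_sym far_exc_D(4,5,6)[of H v]
      unfolding attached_def nbs_def by blast

lemma attached_subset: "attached H v \<subseteq> nbs v"
  unfolding attached_def by blast

lemma finite_attached [simp]: "finite (attached H v)"
  using finite_subset[OF attached_subset] by simp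

text \<open>If \<open>x\<close> were the only attachment, \<open>H\<close> would be an exceptional
  component of \<open>V - {x}\<close>. All \<open>k\<close> such components contain neighbours of
  \<open>x\<close> by connectedness, so \<open>D = Y = {x}\<close> gives 2 + 4k \<le> 4 + k and
  hence k = 0.\<close>

lemma card_attached:
  assumes v: "v \<in> V" and H: "H \<in> far_exc v"
  shows "card (attached H v) \<ge> 2"
proof (rule ccontr)
  assume less: "\<not> card (attached H v) \<ge> 2"
  have "insert v (nbs v) \<subseteq> V" using v unfolding nbs_def by blast
  then obtain y u where yu: "y \<in> insert v (nbs v)" "u \<in> H" "E y u"
    using exc_components_touch[of H "insert v (nbs v)"] H unfolding far_exc_def by blast
  then have "y \<in> attached H v" using far_exc_D[OF H] unfolding attached_def nbs_def by blast
  then have "card (attached H v) = 1" using less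
    by (metis One_nat_def card_0_eq empty_iff finite_attached less_2_cases not_le)
  then obtain x where x: "attached H v = {x}" by (rule card_1_singletonE)
  then have xV: "x \<in> V" using attached_subset nbs_iff by blast
  have "closed_in (V - {x}) H"
    unfolding closed_in_def using far_exc_nbrs[OF H] far_exc_D(4,6)[OF H] x attached_subset by blast
  then have HX: "H \<in> exc_components {x}" using far_exc_D(3)[OF H] by (rule exc_components_I)
  have T: "{C\<in>exc_components {x}. C \<inter> closed_nbhd {x} \<noteq> {}} = exc_components {x}"
  proof -
    have "C \<inter> closed_nbhd {x} \<noteq> {}" if C: "C \<in> exc_components {x}" for C
    proof -
      obtain y u where "y \<in> {x}" "u \<in> C" "E y u" using exc_components_touch[OF C] xV by blast
      then show ?thesis unfolding closed_nbhd_def by blast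
    qed
    then show ?thesis by blast
  qed
  have "card {x} + 1 + 4 * card (exc_components {x}) \<le> 4 * card {x} + card (exc_components {x})"
    using reduce_dom[of "{x}" "{x}"] xV unfolding T by (simp add: closed_nbhd_def)
  then have "3 * card (exc_components {x}) \<le> 2" by simp
  then have "card (exc_components {x}) = 0" by linarith
  then show False using HX by (metis card_0_eq empty_iff finite_exc_components)
qed

text \<open>The choice is \<open>D = {v}\<close> and \<open>Y = N[v]\<close>, a set of at least four
  vertices.\<close>

lemma far_exc_nonempty:
  assumes v: "v \<in> V" and d: "card (nbs v) \<ge> 3"
  shows "far_exc v \<noteq> {}"
proof -
  have "insert v (nbs v) \<subseteq> closed_nbhd {v}" "insert v (nbs v) \<subseteq> V" unfolding closed_nbhd_def nbs_def
      using v by blast+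
  then have "card (insert v (nbs v)) + 1 \<le> 4 * card {v} + card (far_exc v)"
    using reduce_dom[of "insert v (nbs v)" "{v}"] unfolding far_exc_def by simp
  then have "card (far_exc v) \<ge> 1" using d by simp
  then show ?thesis by auto
qed

text \<open>With \<open>D = N(v)\<close> every one of the \<open>k\<close> components is met. For
  degree \<open>d\<close> this gives d + 2 + 4k \<le> 4d + k, so k < d.\<close>

lemma card_far_exc:
  assumes v: "v \<in> V" and d: "card (nbs v) \<ge> 3"
  shows "card (far_exc v) + 1 \<le> card (nbs v)"
proof -
  have ne: "nbs v \<noteq> {}" using d by auto
  have sub: "insert v (nbs v) \<subseteq> closed_nbhd (nbs v)" using ne E_sym
      unfolding closed_nbhd_def nbs_def by blast
  have T: "{C\<in>exc_components (insert v (nbs v)). C \<inter> closed_nbhd (nbs v) \<noteq> {}} = far_exc v"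
  proof -
    have "C \<inter> closed_nbhd (nbs v) \<noteq> {}" if "C \<in> far_exc v" for C
    proof -
      have "attached C v \<noteq> {}" using card_attached[OF v that] card.empty
          by (metis not_numeral_le_zero)
      then show ?thesis unfolding attached_def closed_nbhd_def by blast
    qed
    then show ?thesis unfolding far_exc_def by blast
  qed
  have "insert v (nbs v) \<subseteq> V" using v unfolding nbs_def by blast
  then have "card (insert v (nbs v)) + 1 + 4 * card (far_exc v) \<le> 4 * card (nbs v) + card (far_exc
      v)"
    using reduce_dom[of "insert v (nbs v)" "nbs v"] sub unfolding T unfolding far_exc_def by blast
  then show ?thesis by simp
qed

text \<open>With \<open>D = {x, v}\<close> at least two components are met. For degree
  \<open>d\<close> this forces at least d + 2 of them, against \<open>card_far_exc\<close>.\<close>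

lemma attached_unique:
  assumes v: "v \<in> V" and d: "card (nbs v) \<ge> 3" and H: "H \<in> far_exc v" "H' \<in> far_exc v"
    and x: "x \<in> attached H v" "x \<in> attached H' v"
  shows "H = H'"
proof (rule ccontr)
  assume ne: "H \<noteq> H'"
  have xn: "x \<in> nbs v" using x attached_subset by blast
  then have xv: "x \<noteq> v" by auto
  let ?T = "{C\<in>exc_components (insert v (nbs v)). C \<inter> closed_nbhd {x, v} \<noteq> {}}"
  have "{H, H'} \<subseteq> ?T" using H x unfolding far_exc_def attached_def closed_nbhd_def by blast
  then have "card {H, H'} \<le> card ?T" by (intro card_mono) simp_all
  then have T: "card ?T \<ge> 2" using ne by simp
  have sub: "insert v (nbs v) \<subseteq> closed_nbhd {x, v}" unfolding closed_nbhd_def nbs_def by blast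
  have sub': "insert v (nbs v) \<subseteq> V" using v unfolding nbs_def by blast
  from sub have "card (insert v (nbs v)) + 1 + 4 * card ?T \<le> 4 * card {x, v} + card (far_exc v)"
    using reduce_dom[of "insert v (nbs v)" "{x, v}"] sub' xn unfolding far_exc_def by blast
  then show False using T card_far_exc[OF v d] xv by simp
qed

lemma C6_free:
  "a \<in> V \<Longrightarrow> b \<in> V \<Longrightarrow> c \<in> V \<Longrightarrow> d \<in> V \<Longrightarrow> e \<in> V \<Longrightarrow> f \<in> V \<Longrightarrow> distinct [a, b, c, d, e, f] \<Longrightarrow>
   E a b \<Longrightarrow> E b c \<Longrightarrow> E c d \<Longrightarrow> E d e \<Longrightarrow> E e f \<Longrightarrow> E f a \<Longrightarrow> False"
  using no_C6 unfolding has_C6_def by (metis empty_subsetI insert_subset)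

text \<open>The vertices \<open>v\<close>, \<open>x\<close>, \<open>y\<close>, \<open>m\<close>,
  \<open>y'\<close>, \<open>x'\<close> form a 6-cycle.\<close>

lemma no_two_path:
  assumes v: "v \<in> V" and H: "H \<in> far_exc v" and x: "x \<in> nbs v" "x' \<in> nbs v" "x \<noteq> x'"
    and y: "y \<in> H" "m \<in> H" "y' \<in> H" "y \<noteq> y'" and e: "E x y" "E y m" "E m y'" "E y' x'"
  shows False
proof -
  have "y \<noteq> m" "m \<noteq> y'" using e E_irrefl by metis+
  moreover have "x \<notin> H" "x' \<notin> H" "v \<notin> H" using far_exc_D[OF H] x by blast+
  moreover have "x \<noteq> v" "x' \<noteq> v" using x by auto
  ultimately have "distinct [v, x, y, m, y', x']" using x y by auto
  moreover have "E v x" "E x' v" using x E_sym unfolding nbs_def by blast+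
  ultimately show False
    using C6_free[of v x y m y' x'] v x y e far_exc_D(4)[OF H] nbs_iff by blast
qed

text \<open>A component that misses \<open>v\<close> also misses \<open>N(v)\<close>. If it missed
  \<open>H\<close> as well, it would belong to \<open>far_exc v\<close>; being adjacent to
  \<open>Y\<close>, it would share an attached vertex with \<open>H\<close>, against
  \<open>attached_unique\<close>.\<close>

lemma exc_components_away:
  assumes v: "v \<in> V" and d: "card (nbs v) \<ge> 3" and H: "H \<in> far_exc v"
    and Y: "Y \<subseteq> H \<union> attached H v" "Y \<noteq> {}" and C: "C \<in> exc_components Y" "v \<notin> C"
  shows "C \<inter> H \<noteq> {}" "C \<subseteq> H"
proof -
  have aV: "attached H v \<subseteq> V" "v \<notin> attached H v" unfolding attached_def nbs_def using E_irrefl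
      by blast+
  have YV: "Y \<subseteq> V" "v \<notin> Y" using Y(1) far_exc_D(4,5)[OF H] aV by blast+
  have CN: "C \<inter> nbs v = {}"
    using closed_in_D[OF exc_components_D(1)[OF C(1)], of _ v] C(2) E_sym YV v unfolding nbs_def
        by blast
  have CV: "C \<subseteq> V - insert v (nbs v)" using CN C(2) exc_components_D(4)[OF C(1)] by blast
  show ne: "C \<inter> H \<noteq> {}"
  proof
    assume CH: "C \<inter> H = {}"
    have "closed_in (V - insert v (nbs v)) C"
      unfolding closed_in_def
    proof (intro conjI ballI notI)
      show "C \<subseteq> V - insert v (nbs v)" by fact
      fix a b assume ab: "a \<in> C" "b \<in> V - insert v (nbs v) - C" "E a b"
      then have "b \<in> Y" using closed_in_D[OF exc_components_D(1)[OF C(1)]] by blast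
      then have "b \<in> H" using ab(2) Y attached_subset by blast
      then have "a \<in> H" using closed_in_D[OF far_exc_D(1)[OF H], of b a] ab CV E_sym by blast
      then show False using CH ab by blast
    qed
    then have CH': "C \<in> far_exc v" unfolding far_exc_def using exc_components_D(3)[OF C(1)]
        by (rule exc_components_I)
    obtain y u where yu: "y \<in> Y" "u \<in> C" "E y u" using exc_components_touch[OF C(1) YV(1) Y(2)] .
    have "y \<notin> H" using closed_in_D[OF far_exc_D(1)[OF H], of y u] yu CV CH by blast
    then have y: "y \<in> attached H v" using yu Y by blast
    then have "y \<in> attached C v" using yu unfolding attached_def by blast
    then have "H = C" using attached_unique[OF v d H CH' y] by blast
    then show False using CH far_exc_D(7)[OF H] by blast
  qed
  show "C \<subseteq> H"
    using connected_set_subset_closed_in[OF exc_components_D(2)[OF C(1)] CV far_exc_D(1)[OF H]] ne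
        by blast
qed

text \<open>Once all of \<open>H\<close> is deleted, a component avoiding \<open>v\<close> has no
  room inside \<open>H\<close>.\<close>

lemma exc_components_away_full:
  assumes v: "v \<in> V" and d: "card (nbs v) \<ge> 3" and H: "H \<in> far_exc v"
    and Y: "H \<subseteq> Y" "Y \<subseteq> H \<union> attached H v" and C: "C \<in> exc_components Y"
  shows "v \<in> C"
proof (rule ccontr)
  assume "v \<notin> C"
  then have "C \<inter> H \<noteq> {}" using exc_components_away(1)[OF v d H Y(2) _ C] Y far_exc_D(7)[OF H]
      by blast
  then show False using Y exc_components_D(4)[OF C] by blast
qed

lemma exc_components_card_le_1:
  assumes "\<And>C. C \<in> exc_components Y \<Longrightarrow> v \<in> C"
  shows "card (exc_components Y) \<le> 1"
proof -
  have "C = C'" if "C \<in> exc_components Y" "C' \<in> exc_components Y" for C C'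
  proof (rule exc_components_disjoint[OF that])
    have "v \<in> C \<inter> C'" by (rule IntI) (rule assms, rule that)+
    then show "C \<inter> C' \<noteq> {}" by (metis empty_iff)
  qed
  then show ?thesis unfolding One_nat_def card_le_Suc0_iff_eq[OF finite_exc_components]
      by (intro ballI)
qed

text \<open>At most one exceptional component contains \<open>v\<close>, so \<open>D = {y}\<close>
  gives \<open>card Y + 1 \<le> 4 + 1\<close>. Equality requires that component to exist; this is
  the source of \<open>K\<close> in \<open>config\<close>.\<close>

lemma dominate_bound:
  assumes v: "v \<in> V" and Y: "Y \<subseteq> V" "y \<in> Y"
    and sp: "sparse (Y - closed_nbhd {y})" "\<And>u w. u \<in> Y - closed_nbhd {y} \<Longrightarrow> w \<in> V - Y \<Longrightarrow> \<not> E u w"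
    and C: "\<And>C. C \<in> exc_components Y \<Longrightarrow> v \<in> C"
  shows "card Y \<le> 4" "card Y = 4 \<Longrightarrow> \<exists>K\<in>exc_components Y. v \<in> K"
proof -
  have "Y \<noteq> {}" "{y} \<subseteq> Y" using Y(2) by auto
  then have *: "card Y + 1 \<le> 4 + card (exc_components Y)" using reduce[OF Y(1) _ _ sp] by simp
  moreover have "card (exc_components Y) \<le> 1" using C by (rule exc_components_card_le_1)
  ultimately show "card Y \<le> 4" by linarith
  assume "card Y = 4"
  then have "exc_components Y \<noteq> {}" using * by (metis One_nat_def add.right_neutral card.empty
      add_le_cancel_left not_one_le_zero)
  then show "\<exists>K\<in>exc_components Y. v \<in> K" using C by blast
qed

subsection \<open>Exceptional components far from a vertex of degree at least three\<close>

text \<open>The tight situation: \<open>b\<close> is the only vertex of \<open>H\<close> adjacent to \<open>x2\<close>, all vertices of \<open>H\<close>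
  adjacent to \<open>x1\<close> are neighbours of \<open>b\<close> in \<open>H\<close>, and the component \<open>K\<close> of \<open>v\<close> left by
  deleting the closed neighbourhood of \<open>b\<close> is exceptional as well.\<close>

definition config :: "'a \<Rightarrow> 'a set \<Rightarrow> 'a \<Rightarrow> 'a \<Rightarrow> 'a \<Rightarrow> 'a set \<Rightarrow> bool" where
  "config v H b x1 x2 K \<longleftrightarrow> b \<in> H \<and> x1 \<in> nbs v \<and> x2 \<in> nbs v \<and> x1 \<noteq> x2 \<and>
     (\<forall>x\<in>nbs v. E x b \<longleftrightarrow> x = x2) \<and> (\<forall>y\<in>H. E x2 y \<longrightarrow> y = b) \<and>
     (\<exists>y\<in>H. E x1 y) \<and> (\<forall>y\<in>H. E x1 y \<longrightarrow> E b y) \<and>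
     (\<forall>x\<in>nbs v. \<forall>y\<in>H. E x y \<longrightarrow> x = x1 \<or> x = x2) \<and>
     (\<exists>a c. nbs b \<inter> H = {a, c} \<and> a \<noteq> c \<and> \<not> E a c) \<and>
     K \<in> exc_components (insert b (nbs b)) \<and> v \<in> K \<and> K \<inter> H = {}"

text \<open>The choice is \<open>D = {y}\<close>, with \<open>Y\<close> consisting of
  \<open>H\<close> and the neighbours of \<open>y\<close> in \<open>N(v)\<close>. By
  \<open>un\<close> the vertices of \<open>H\<close> not dominated by \<open>y\<close> send no edges
  out of \<open>H\<close>, and there are at most two of them.\<close>

lemma triple_bound:
  assumes v: "v \<in> V" and d: "card (nbs v) \<ge> 3" and H: "H \<in> far_exc v" and H3: "card H = 3"
    and y: "y \<in> H" and un: "\<And>u x. u \<in> H \<Longrightarrow> u \<noteq> y \<Longrightarrow> \<not> E y u \<Longrightarrow> x \<in> nbs v \<Longrightarrow> \<not> E x u"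
  shows "card (nbs y \<inter> nbs v) \<le> 1"
    and "card (nbs y \<inter> nbs v) = 1 \<Longrightarrow> \<exists>K\<in>exc_components (H \<union> (nbs y \<inter> nbs v)). v \<in> K"
proof -
  let ?Y = "H \<union> (nbs y \<inter> nbs v)"
  have fH: "finite H" using far_exc_D(4)[OF H] finite_subset_V by blast
  have YV: "?Y \<subseteq> V" using far_exc_D(4)[OF H] unfolding nbs_def by blast
  have left: "?Y - closed_nbhd {y} \<subseteq> {u\<in>H. u \<noteq> y \<and> \<not> E y u}" unfolding closed_nbhd_def nbs_def
      by blast
  have "card (H - {y}) = 2" using H3 y fH by simp
  moreover have "card (?Y - closed_nbhd {y}) \<le> card (H - {y})"
    using left fH by (intro card_mono) auto
  moreover have "finite (?Y - closed_nbhd {y})" using fH by simp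
  ultimately have sp: "sparse (?Y - closed_nbhd {y})" by (intro sparse_card_le_2) simp_all
  have free: "\<not> E u w" if u: "u \<in> ?Y - closed_nbhd {y}" and w: "w \<in> V - ?Y" for u w
  proof
    assume e: "E u w"
    have uH: "u \<in> H" "u \<noteq> y" "\<not> E y u" using left u by blast+
    have "w \<in> attached H v" using far_exc_nbrs[OF H uH(1) e] w by blast
    then show False using un[OF uH] attached_subset e E_sym by blast
  qed
  have C: "v \<in> C" if "C \<in> exc_components ?Y" for C
  proof (rule exc_components_away_full[OF v d H _ _ that])
    show "H \<subseteq> ?Y" by blast
    show "?Y \<subseteq> H \<union> attached H v" using y E_sym unfolding attached_def nbs_def by blast
  qed
  have card: "card ?Y = 3 + card (nbs y \<inter> nbs v)"
    using far_exc_D(6)[OF H] fH H3 by (subst card_Un_disjoint) auto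
  have yY: "y \<in> ?Y" using y by blast
  show "card (nbs y \<inter> nbs v) \<le> 1"
    using dominate_bound(1)[OF v YV yY sp free C] card by linarith
  assume "card (nbs y \<inter> nbs v) = 1"
  then have "card ?Y = 4" using card by simp
  then show "\<exists>K\<in>exc_components ?Y. v \<in> K" using dominate_bound(2)[OF v YV yY sp free C] by blast
qed

text \<open>Since \<open>b\<close> dominates \<open>H\<close>, \<open>triple_bound\<close> at
  \<open>b\<close> makes \<open>x2\<close> its only neighbour in \<open>N(v)\<close> and yields
  \<open>K\<close>. Vertices of \<open>N(v)\<close> adjacent to \<open>a\<close> and to
  \<open>c\<close> coincide by \<open>no_two_path\<close>. If none is adjacent to \<open>c\<close>,
  \<open>triple_bound\<close> applies at \<open>a\<close> and shows that only \<open>x1\<close> is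
  adjacent to \<open>a\<close>.\<close>

lemma config_path:
  assumes v: "v \<in> V" and d: "card (nbs v) \<ge> 3" and H: "H \<in> far_exc v"
    and abc: "H = {a, b, c}" "distinct [a, b, c]" "E a b" "E b c" "\<not> E a c"
    and x: "x1 \<in> nbs v" "x2 \<in> nbs v" "x1 \<noteq> x2" "E x1 a" "E x2 b"
  shows "\<exists>K. config v H b x1 x2 K"
proof -
  have H3: "card H = 3" using abc by simp
  have inH: "a \<in> H" "b \<in> H" "c \<in> H" using abc by blast+
  note tri = triple_bound[OF v d H H3]
  have unb: "\<not> E x u" if "u \<in> H" "u \<noteq> b" "\<not> E b u" for u x
    using that abc E_sym by blast
  have b1: "card (nbs b \<inter> nbs v) \<le> 1" using tri(1)[OF inH(2) unb] .
  have x2: "x2 \<in> nbs b \<inter> nbs v" using x E_sym unfolding nbs_def by blast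
  have Xb: "nbs b \<inter> nbs v = {x2}"
    using card_seteq[of "nbs b \<inter> nbs v" "{x2}"] b1 x2 by simp
  obtain K where K: "K \<in> exc_components (H \<union> (nbs b \<inter> nbs v))" "v \<in> K"
    using tri(2)[OF inH(2) unb] Xb by auto
  have Yb: "H \<union> (nbs b \<inter> nbs v) = insert b (nbs b)"
  proof
    show "H \<union> (nbs b \<inter> nbs v) \<subseteq> insert b (nbs b)"
      using abc E_sym far_exc_D(4)[OF H] unfolding nbs_def by blast
    show "insert b (nbs b) \<subseteq> H \<union> (nbs b \<inter> nbs v)"
    proof
      fix w assume "w \<in> insert b (nbs b)"
      then consider "w = b" | "w \<in> nbs b" "E b w" "w \<in> V" unfolding nbs_def by blast
      then show "w \<in> H \<union> (nbs b \<inter> nbs v)"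
      proof cases
        case 1 then show ?thesis using inH by blast
      next
        case 2 then show ?thesis using far_exc_nbrs[OF H inH(2) 2(2,3)] attached_subset[of H v]
            by blast
      qed
    qed
  qed
  have c_to_a: "x = x'" if "x \<in> nbs v" "E x c" "x' \<in> nbs v" "E x' a" for x x'
  proof (rule ccontr)
    assume ne: "x \<noteq> x'"
    have "a \<noteq> c" using abc by simp
    then show False
      using no_two_path[OF v H that(3,1) _ inH(1,2,3)] ne that abc(3,4) E_sym by blast
  qed
  have x1a: "x1 \<in> nbs a \<inter> nbs v" using x E_sym unfolding nbs_def by blast
  have Xa: "x = x1" if "x \<in> nbs v" "E x a" for x
  proof (cases "\<exists>z\<in>nbs v. E z c")
    case True
    then show ?thesis using c_to_a that x(1,4) by blast
  next
    case False
    then have "\<not> E z u" if "u \<in> H" "u \<noteq> a" "\<not> E a u" "z \<in> nbs v" for u z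
      using that abc by blast
    then have "card (nbs a \<inter> nbs v) \<le> 1" using tri(1)[OF inH(1)] by blast
    then have "nbs a \<inter> nbs v = {x1}" using card_seteq[of "nbs a \<inter> nbs v" "{x1}"] x1a by simp
    then show ?thesis using that E_sym unfolding nbs_def by blast
  qed
  have Xc: "x = x1" if "x \<in> nbs v" "E x c" for x
    using c_to_a[OF that x(1,4)] .
  have Xb': "x = x2" if "x \<in> nbs v" "E x b" for x
    using Xb that E_sym unfolding nbs_def by blast
  have "nbs b \<inter> H = {a, c}"
    using abc E_sym E_irrefl far_exc_D(4)[OF H] unfolding nbs_def by blast
  then have nbb: "\<exists>a c. nbs b \<inter> H = {a, c} \<and> a \<noteq> c \<and> \<not> E a c" using abc by auto
  have K': "K \<in> exc_components (insert b (nbs b))" using K Yb by simp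
  have KH: "K \<inter> H = {}" using exc_components_D(4)[OF K(1)] by blast
  have x2b: "\<forall>y\<in>H. E x2 y \<longrightarrow> y = b" using Xa Xc x abc(1) by blast
  have x1n: "\<forall>y\<in>H. E x1 y \<longrightarrow> E b y" using Xb' x abc E_sym by blast
  have all: "\<forall>x\<in>nbs v. \<forall>y\<in>H. E x y \<longrightarrow> x = x1 \<or> x = x2" using Xa Xb' Xc abc(1) by blast
  have "\<forall>x\<in>nbs v. E x b \<longleftrightarrow> x = x2" using Xb' x by blast
  moreover have "\<exists>y\<in>H. E x1 y" using inH x by blast
  ultimately have "config v H b x1 x2 K"
    unfolding config_def using nbb K' K(2) KH x2b x1n all x inH by blast
  then show ?thesis by blast
qed

text \<open>If all edges from \<open>N(v)\<close> to \<open>H\<close> ended in one vertex,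
  \<open>triple_bound\<close> would allow only one attached vertex. Hence there are two disjoint
  edges, ending in \<open>y1\<close> and \<open>y2\<close>, and the forbidden path
  \<open>y1\<close>, \<open>z\<close>, \<open>y2\<close> leaves for \<open>H\<close> only a path
  with middle \<open>y1\<close> or \<open>y2\<close>.\<close>

lemma config_triple:
  assumes v: "v \<in> V" and d: "card (nbs v) \<ge> 3" and H: "H \<in> far_exc v" and H3: "card H = 3"
  shows "\<exists>b x1 x2 K. config v H b x1 x2 K"
proof -
  have att2: "card (attached H v) \<ge> 2" using card_attached[OF v H] .
  have not_single: "\<not> (\<forall>x\<in>nbs v. \<forall>u\<in>H. E x u \<longrightarrow> u = y)" if y: "y \<in> H" for y
  proof
    assume s: "\<forall>x\<in>nbs v. \<forall>u\<in>H. E x u \<longrightarrow> u = y"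
    then have "card (nbs y \<inter> nbs v) \<le> 1" by (intro triple_bound(1)[OF v d H H3 y]) blast
    moreover have "attached H v = nbs y \<inter> nbs v"
      using s y far_exc_D(4)[OF H] E_sym unfolding attached_def nbs_def by blast
    ultimately show False using att2 by simp
  qed
  have ex_other: "\<exists>x'\<in>attached H v. x' \<noteq> x" for x
  proof (rule ccontr)
    assume "\<not> ?thesis"
    then have "attached H v \<subseteq> {x}" by blast
    then have "card (attached H v) \<le> card {x}" by (intro card_mono) simp_all
    then show False using att2 by simp
  qed
  obtain x u where xu: "x \<in> nbs v" "u \<in> H" "E x u" using ex_other unfolding attached_def by blast
  obtain x' u' where xu': "x' \<in> nbs v" "u' \<in> H" "E x' u'" "u' \<noteq> u" using not_single[OF xu(2)]
      by blast
  obtain x1 x2 y1 y2 where m: "x1 \<in> nbs v" "x2 \<in> nbs v" "x1 \<noteq> x2" "y1 \<in> H" "y2 \<in> H" "y1 \<noteq> y2"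
      "E x1 y1" "E x2 y2"
  proof (cases "x = x'")
    case False
    then show ?thesis using that xu xu' by blast
  next
    case True
    obtain z w where "z \<in> nbs v" "w \<in> H" "E z w" "z \<noteq> x" using ex_other[of x] unfolding attached_def
        by blast
    \<comment> \<open>The edge from \<open>z\<close> to \<open>w\<close> is paired with the edge
      from \<open>x\<close> to whichever of \<open>u\<close> and \<open>u'\<close> differs from
      \<open>w\<close>.\<close>
    then show ?thesis using that[of x z u w] that[of x' z u' w] xu xu' True by metis
  qed
  have fH: "finite H" using far_exc_D(4)[OF H] finite_subset_V by blast
  have "card (H - {y1, y2}) = 1" using H3 m fH by (simp add: card_Diff_subset)
  then obtain z where "H - {y1, y2} = {z}" by (rule card_1_singletonE)
  then have z: "H = {y1, y2, z}" "z \<noteq> y1" "z \<noteq> y2" using m by blast+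
  have step: "\<exists>w\<in>H. E u w" if "u \<in> H" for u
  proof (rule ccontr)
    assume "\<not> ?thesis"
    then have "closed_in H {u}" using that unfolding closed_in_def by blast
    then have "H = {u}" using far_exc_D(2)[OF H] unfolding connected_set_def by blast
    then show False using H3 by simp
  qed
  have nz: "\<not> (E y1 z \<and> E z y2)"
    using no_two_path[OF v H m(1,2,3,4) _ m(5,6,7)] z(1) m(8) E_sym by blast
  have "E z y1 \<or> E z y2" using step[of z] z E_irrefl by blast
  then show ?thesis
  proof
    assume a: "E z y2"
    then have n: "\<not> E y1 z" using nz by blast
    then have "E y1 y2" using step[of y1] z E_irrefl by blast
    then show ?thesis
      using config_path[OF v d H z(1) _ _ _ n m(1,2,3,7,8)] z m a E_sym by auto
  next
    assume a: "E z y1"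
    then have n: "\<not> E y2 z" using nz E_sym by blast
    then have e: "E y2 y1" using step[of y2] z E_irrefl by blast
    have "H = {y2, y1, z}" using z by blast
    then show ?thesis
      using config_path[OF v d H _ _ e _ n m(2,1) m(3)[symmetric] m(8,7)] z m a E_sym by auto
  qed
qed

text \<open>The choice is \<open>D = {y}\<close> and \<open>Y = N[y]\<close>. An exceptional
  component missing \<open>v\<close> would be the remainder of the cycle, whose order is wrong. So
  \<open>dominate_bound\<close> allows four vertices in \<open>N[y]\<close>: \<open>y\<close>, its
  two neighbours on the cycle and \<open>x\<close>. Equality provides \<open>K\<close>.\<close>

lemma cycle_attached:
  assumes v: "v \<in> V" and d: "card (nbs v) \<ge> 3" and H: "H \<in> far_exc v"
    and c: "cycle_on m c H" and m: "m = 7 \<or> m = 11"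
    and y: "y \<in> H" and x: "x \<in> nbs v" "E x y"
  shows "\<And>x'. x' \<in> nbs v \<Longrightarrow> E x' y \<Longrightarrow> x' = x"
    and "\<And>x' u. x' \<in> nbs v \<Longrightarrow> x' \<noteq> x \<Longrightarrow> u \<in> H \<Longrightarrow> E x' u \<Longrightarrow> E y u"
    and "\<exists>K\<in>exc_components (insert y (nbs y)). v \<in> K \<and> K \<inter> H = {}"
proof -
  let ?Y = "insert y (nbs y)"
  let ?R = "H - closed_nbhd {y}"
  have fH: "finite H" using far_exc_D(4)[OF H] finite_subset_V by blast
  have YV: "?Y \<subseteq> V" using y far_exc_D(4)[OF H] unfolding nbs_def by blast
  have Yd: "?Y - closed_nbhd {y} = {}" unfolding closed_nbhd_def nbs_def by blast
  then have sp: "sparse (?Y - closed_nbhd {y})" and free: "\<And>u w. u \<in> ?Y - closed_nbhd {y}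
      \<Longrightarrow> w \<in> V - ?Y \<Longrightarrow> \<not> E u w"
    unfolding sparse_def by blast+
  have Yatt: "?Y \<subseteq> H \<union> attached H v" using far_exc_nbrs[OF H y] y unfolding nbs_def by blast
  have R: "connected_set ?R" "card ?R \<in> {4, 8}" using cycle_on_remainder[OF c m y] .
  have RV: "?R \<subseteq> V - ?Y" using far_exc_D(4)[OF H] unfolding closed_nbhd_def nbs_def by blast
  have C: "v \<in> C" if C: "C \<in> exc_components ?Y" for C
  proof (rule ccontr)
    assume nv: "v \<notin> C"
    have CH: "C \<inter> H \<noteq> {}" "C \<subseteq> H" using exc_components_away[OF v d H Yatt _ C nv] by blast+
    have "C \<subseteq> ?R" using CH(2) exc_components_D(4)[OF C] unfolding closed_nbhd_def nbs_def by blast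
    moreover have "?R \<inter> C \<noteq> {}" using calculation CH(1) by blast
    then have "?R \<subseteq> C" by (rule connected_set_subset_closed_in[OF R(1) RV exc_components_D(1)[OF
        C]])
    ultimately have "C = ?R" by blast
    then show False using R(2) exceptional_card[OF exc_components_D(3)[OF C]] by auto
  qed
  obtain a a' where a: "{w\<in>H. E y w} = {a, a'}" "a \<noteq> a'" "\<not> E a a'"
      using cycle_on_two_nbrs[OF c m y] .
  have aH: "a \<in> H" "a' \<in> H" "E y a" "E y a'" using a(1) by blast+
  have sub: "insert y {a, a'} \<union> (nbs y \<inter> nbs v) \<subseteq> ?Y" using aH far_exc_D(4)[OF H] unfolding nbs_def
      by blast
  have fin3: "card (insert y {a, a'}) = 3" using a(2) aH E_irrefl by (metis card_3_iff)
  have dis: "insert y {a, a'} \<inter> (nbs y \<inter> nbs v) = {}" using far_exc_D(6)[OF H] y aH by blast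
  have "card (insert y {a, a'} \<union> (nbs y \<inter> nbs v)) = 3 + card (nbs y \<inter> nbs v)"
    using fin3 dis by (subst card_Un_disjoint) auto
  then have ge: "3 + card (nbs y \<inter> nbs v) \<le> card ?Y" using card_mono[OF _ sub] by simp
  have yY: "y \<in> ?Y" by blast
  have le: "card ?Y \<le> 4" using dominate_bound(1)[OF v YV yY sp free C] .
  have xin: "x \<in> nbs y \<inter> nbs v" using x E_sym unfolding nbs_def by blast
  then have "card (nbs y \<inter> nbs v) \<noteq> 0" by (metis card_0_eq empty_iff finite_Int finite_nbs)
  then have c1: "card (nbs y \<inter> nbs v) = 1" "card ?Y = 4" using ge le by linarith+
  have Xy: "nbs y \<inter> nbs v = {x}" using c1(1) xin by (metis card_1_singletonE singletonD)
  show u1: "x' = x" if "x' \<in> nbs v" "E x' y" for x'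
    using Xy that E_sym unfolding nbs_def by blast
  obtain K where K: "K \<in> exc_components ?Y" "v \<in> K"
      using dominate_bound(2)[OF v YV yY sp free C c1(2)] by blast
  \<comment> \<open>If \<open>K\<close> met \<open>H\<close>, it would contain the whole remainder
    and so be a cycle. The vertex \<open>f\<close> two steps from \<open>y\<close> on
    \<open>H\<close> has its neighbour \<open>a\<close> outside \<open>K\<close>, so one of its two
    neighbours in \<open>K\<close> lies outside \<open>H\<close>, hence in \<open>N(v)\<close>. The
    path \<open>y\<close>, \<open>a\<close>, \<open>f\<close> then contradicts
    \<open>no_two_path\<close>.\<close>
  have KH: "K \<inter> H = {}"
  proof (rule ccontr)
    assume ne: "K \<inter> H \<noteq> {}"
    have fK: "finite K" using exceptional_finite exc_components_D(3)[OF K(1)] .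
    have "K \<inter> H \<subseteq> ?R" using exc_components_D(4)[OF K(1)] unfolding closed_nbhd_def nbs_def by blast
    then have "?R \<inter> K \<noteq> {}" using ne by blast
    then have RK: "?R \<subseteq> K" by (rule connected_set_subset_closed_in[OF R(1) RV exc_components_D(1)[OF
        K(1)]])
    then have "card ?R \<le> card K" using fK by (intro card_mono)
    then have "card K \<noteq> 3" using R(2) by auto
    then obtain m' k where k: "m' = 7 \<or> m' = 11" "cycle_on m' k K"
        using exceptional_cases[OF exc_components_D(3)[OF K(1)]] by metis
    obtain e e' where e: "{w\<in>H. E a w} = {e, e'}" "e \<noteq> e'" "\<not> E e e'"
        using cycle_on_two_nbrs[OF c m aH(1)] .
    have "y \<in> {e, e'}" using e(1) y aH E_sym by blast
    then obtain f where f: "f \<in> H" "E a f" "f \<noteq> y" "\<not> E y f"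
      using e E_sym by blast
    then have fK: "f \<in> K" using RK unfolding closed_nbhd_def by blast
    have aK: "a \<notin> K" using exc_components_D(4)[OF K(1)] aH far_exc_D(4)[OF H] unfolding nbs_def
        by blast
    obtain h h' where h: "{w\<in>H. E f w} = {h, h'}" using cycle_on_two_nbrs[OF c m f(1)] .
    obtain g g' where g: "{w\<in>K. E f w} = {g, g'}" "g \<noteq> g'" using cycle_on_two_nbrs[OF k(2,1) fK] .
    have "a \<in> {h, h'}" using h f aH E_sym by blast
    have "\<exists>w\<in>K. E f w \<and> w \<notin> H"
    proof (rule ccontr)
      assume "\<not> ?thesis"
      then have "{g, g'} \<subseteq> {h, h'} - {a}" using g(1) h aK by blast
      then show False using \<open>a \<in> {h, h'}\<close> g(2) by blast
    qed
    then obtain w where w: "w \<in> K" "E f w" "w \<notin> H" by blast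
    have "w \<in> V" using w exc_components_D(4)[OF K(1)] by blast
    then have "w \<in> nbs v" using far_exc_nbrs[OF H f(1) w(2)] w(3) attached_subset by blast
    moreover have "w \<noteq> x" using w(1) exc_components_D(4)[OF K(1)] xin by blast
    ultimately show False
      using no_two_path[OF v H x(1) _ _ y aH(1) f(1) _ x(2) aH(3) f(2) w(2)] f(3) by blast
  qed
  \<comment> \<open>As a neighbour of \<open>v\<close> outside \<open>N[y]\<close>,
    \<open>x'\<close> lies in \<open>K\<close>. Since \<open>K\<close> misses \<open>H\<close>, the
    neighbour \<open>u\<close> of \<open>x'\<close> must have been deleted with
    \<open>N[y]\<close>.\<close>
  show "E y u" if x': "x' \<in> nbs v" "x' \<noteq> x" and u: "u \<in> H" "E x' u" for x' u
  proof -
    have V: "x' \<in> V" "E v x'" "u \<in> V" using x' u far_exc_D(4)[OF H] unfolding nbs_def by blast+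
    have "x' \<noteq> y" using x'(1) y far_exc_D(6)[OF H] by blast
    then have "x' \<notin> ?Y" using u1[OF x'(1)] x'(2) E_sym unfolding nbs_def by blast
    then have "x' \<in> K" using closed_in_D[OF exc_components_D(1)[OF K(1)] K(2) V(2)] V by blast
    then have "u \<in> ?Y" using closed_in_D[OF exc_components_D(1)[OF K(1)] _ u(2)] V(3) KH u(1)
        by blast
    moreover have "u \<noteq> y" using u1[OF x'(1)] x'(2) u(2) by blast
    ultimately show ?thesis unfolding nbs_def by blast
  qed
  show "\<exists>K\<in>exc_components ?Y. v \<in> K \<and> K \<inter> H = {}" using K KH by blast
qed

text \<open>Applied at \<open>b\<close>, \<open>cycle_attached\<close> supplies the parts of
  \<open>config\<close> that concern \<open>K\<close> and the location of the neighbours of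
  \<open>x1\<close>.\<close>

lemma config_cycle_aux:
  assumes v: "v \<in> V" and d: "card (nbs v) \<ge> 3" and H: "H \<in> far_exc v"
    and c: "cycle_on m c H" and m: "m = 7 \<or> m = 11"
    and x: "x1 \<in> nbs v" "x2 \<in> nbs v" "x1 \<noteq> x2" and y: "y1 \<in> H" "E x1 y1" "b \<in> H" "E x2 b"
    and single: "\<And>u. u \<in> H \<Longrightarrow> E x2 u \<Longrightarrow> u = b"
    and two: "\<forall>x\<in>nbs v. \<forall>y\<in>H. E x y \<longrightarrow> x = x1 \<or> x = x2"
  shows "\<exists>K. config v H b x1 x2 K"
proof -
  note at = cycle_attached[OF v d H c m y(3) x(2) y(4)]
  obtain K where K: "K \<in> exc_components (insert b (nbs b))" "v \<in> K" "K \<inter> H = {}" using at(3)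
      by blast
  obtain a a' where a: "{w\<in>H. E b w} = {a, a'}" "a \<noteq> a'" "\<not> E a a'"
      using cycle_on_two_nbrs[OF c m y(3)] .
  have "nbs b \<inter> H = {w\<in>H. E b w}" using far_exc_D(4)[OF H] unfolding nbs_def by blast
  then have nbb: "\<exists>a c. nbs b \<inter> H = {a, c} \<and> a \<noteq> c \<and> \<not> E a c" using a by metis
  have "\<forall>x\<in>nbs v. E x b \<longleftrightarrow> x = x2" using at(1) y(4) by blast
  moreover have "\<forall>y\<in>H. E x1 y \<longrightarrow> E b y" using at(2)[OF x(1,3)] by blast
  moreover have "\<forall>y\<in>H. E x2 y \<longrightarrow> y = b" using single by blast
  moreover have "\<exists>y\<in>H. E x1 y" using y(1,2) by (rule bexI[rotated])
  ultimately have "config v H b x1 x2 K"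
    unfolding config_def using x y(3) two nbb K by (intro conjI)
  then show ?thesis by blast
qed

text \<open>A third attached vertex would be adjacent to some \<open>y\<close>, and the path
  \<open>y2\<close>, \<open>y1\<close>, \<open>y\<close> would contradict
  \<open>no_two_path\<close>. So there are only \<open>x1\<close> and \<open>x2\<close>, and it
  remains to see that one of them has a single neighbour in \<open>H\<close>.\<close>

lemma config_cycle:
  assumes v: "v \<in> V" and d: "card (nbs v) \<ge> 3" and H: "H \<in> far_exc v"
    and c: "cycle_on m c H" and m: "m = 7 \<or> m = 11"
  shows "\<exists>b x1 x2 K. config v H b x1 x2 K"
proof -
  note at = cycle_attached[OF v d H c m]
  have att2: "card (attached H v) \<ge> 2" using card_attached[OF v H] .
  have ex_other: "\<exists>x'\<in>attached H v. x' \<noteq> x" for x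
  proof (rule ccontr)
    assume "\<not> ?thesis"
    then have "attached H v \<subseteq> {x}" by blast
    then have "card (attached H v) \<le> card {x}" by (intro card_mono) simp_all
    then show False using att2 by simp
  qed
  obtain x1 y1 where 1: "x1 \<in> nbs v" "y1 \<in> H" "E x1 y1" using ex_other[of v] unfolding attached_def
      by blast
  obtain x2 y2 where 2: "x2 \<in> nbs v" "y2 \<in> H" "E x2 y2" "x2 \<noteq> x1" using ex_other[of x1]
      unfolding attached_def by blast
  have two: "\<forall>x\<in>nbs v. \<forall>y\<in>H. E x y \<longrightarrow> x = x1 \<or> x = x2"
  proof (intro ballI impI, rule ccontr)
    fix x y assume x: "x \<in> nbs v" "y \<in> H" "E x y" "\<not> (x = x1 \<or> x = x2)"
    have e: "E y1 y" "E y1 y2" using at(2)[OF 1(2,1,3)] x 2 by blast+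
    have ne: "y \<noteq> y2" using at(1)[OF 2(2,1,3) x(1)] x by blast
    show False
      using no_two_path[OF v H 2(1) x(1) _ 2(2) 1(2) x(2)] 2(3) e ne x(3,4) E_sym by blast
  qed
  then have two': "\<forall>x\<in>nbs v. \<forall>y\<in>H. E x y \<longrightarrow> x = x2 \<or> x = x1" by blast
  show ?thesis
  proof (cases "\<forall>u\<in>H. E x2 u \<longrightarrow> u = y2")
    case True
    then show ?thesis
      using config_cycle_aux[OF v d H c m 1(1) 2(1) 2(4)[symmetric] 1(2,3) 2(2,3) _ two] by blast
  next
    case False
    then obtain y2' where y2': "y2' \<in> H" "E x2 y2'" "y2' \<noteq> y2" by blast
    \<comment> \<open>Every neighbour of \<open>x1\<close> in \<open>H\<close> is adjacent to both
      \<open>y2\<close> and \<open>y2'\<close>, and a cycle of length 7 or 11 has only one such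
      vertex. The roles of \<open>x1\<close> and \<open>x2\<close> are then exchanged.\<close>
    have "u = y1" if u: "u \<in> H" "E x1 u" for u
    proof -
      have "E u y2" "E u y2'" using at(2)[OF u(1) 1(1) u(2) 2(1) 2(4)] 2(2,3) y2' by blast+
      moreover have "E y1 y2" "E y1 y2'" using at(2)[OF 1(2,1,3) 2(1) 2(4)] 2(2,3) y2' by blast+
      ultimately show ?thesis
        using cycle_on_no_C4[OF c m u(1) 1(2) 2(2) y2'(1)] y2'(3) by blast
    qed
    then show ?thesis
      using config_cycle_aux[OF v d H c m 2(1) 1(1) 2(4) 2(2,3) 1(2,3) _ two'] by blast
  qed
qed

lemma config_exists:
  assumes v: "v \<in> V" and d: "card (nbs v) \<ge> 3"
  shows "\<exists>H b x1 x2 K. H \<in> far_exc v \<and> config v H b x1 x2 K"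
proof -
  obtain H where H: "H \<in> far_exc v" using far_exc_nonempty[OF v d] by blast
  show ?thesis
  proof (rule exceptional_cases[OF far_exc_D(3)[OF H]])
    assume "card H = 3"
    then show ?thesis using config_triple[OF v d H] H by blast
  next
    fix m c assume "m = 7 \<or> m = 11" "cycle_on m c H"
    then show ?thesis using config_cycle[OF v d H] H by blast
  qed
qed

section \<open>Bounding the degree by three and then by two\<close>

lemma degree_le_3:
  assumes v: "v \<in> V"
  shows "card (nbs v) \<le> 3"
proof (rule ccontr)
  assume "\<not> card (nbs v) \<le> 3"
  then have d: "card (nbs v) \<ge> 4" by simp
  then obtain H b x1 x2 K where H: "H \<in> far_exc v" and c: "config v H b x1 x2 K"
    using config_exists[OF v] by fastforce
  have K: "K \<in> exc_components (insert b (nbs b))" "v \<in> K" and b: "b \<in> H" and x2: "x2 \<in> nbs v"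
    and xb: "\<And>x. x \<in> nbs v \<Longrightarrow> E x b \<longleftrightarrow> x = x2"
    using c unfolding config_def by blast+
  \<comment> \<open>Deleting \<open>N[b]\<close> removes only \<open>x2\<close> from
    \<open>N(v)\<close>, so all other neighbours of \<open>v\<close> lie in the exceptional set
    \<open>K\<close>, where degrees are at most two.\<close>
  have sub: "nbs v - {x2} \<subseteq> {w\<in>K. E v w}"
  proof
    fix w assume w: "w \<in> nbs v - {x2}"
    then have "w \<notin> insert b (nbs b)"
      using xb[of w] b far_exc_D(6)[OF H] E_sym unfolding nbs_def by blast
    then have "w \<in> K" using closed_in_D[OF exc_components_D(1)[OF K(1)] K(2), of w] w
        unfolding nbs_def by blast
    then show "w \<in> {w\<in>K. E v w}" using w unfolding nbs_def by blast
  qed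
  have "card (nbs v - {x2}) \<le> card {w\<in>K. E v w}"
    using sub exceptional_finite[OF exc_components_D(3)[OF K(1)]] by (intro card_mono) simp_all
  then have "card (nbs v - {x2}) \<le> 2" using exceptional_degree[OF exc_components_D(3)[OF K(1)] K(2)]
      by linarith
  then show False using d x2 by simp
qed

text \<open>Here \<open>x1\<close> is adjacent to both neighbours of \<open>b\<close> in
  \<open>H\<close>. The degree bound makes \<open>K\<close> the path \<open>x1\<close>,
  \<open>v\<close>, \<open>x3\<close>, and then \<open>x1\<close> dominates too much: four vertices
  of a set of five that is cut off after adding the pendant vertex \<open>x3\<close>.\<close>

lemma config_double_contra:
  assumes v: "v \<in> V" and d: "card (nbs v) = 3" and H: "H \<in> far_exc v" and c: "config v H b x1 x2 K"
    and ac: "nbs b \<inter> H = {a, c}" "a \<noteq> c" "E x1 a" "E x1 c"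
  shows False
proof -
  have K: "K \<in> exc_components (insert b (nbs b))" "v \<in> K" "K \<inter> H = {}" and b: "b \<in> H"
    and x: "x1 \<in> nbs v" "x2 \<in> nbs v" "x1 \<noteq> x2"
    and xb: "\<And>x. x \<in> nbs v \<Longrightarrow> E x b \<longleftrightarrow> x = x2"
    and x2b: "\<And>y. y \<in> H \<Longrightarrow> E x2 y \<Longrightarrow> y = b"
    and only: "\<And>x y. x \<in> nbs v \<Longrightarrow> y \<in> H \<Longrightarrow> E x y \<Longrightarrow> x = x1 \<or> x = x2"
    using c unfolding config_def by blast+
  have "card (nbs v - {x1, x2}) = 1" using d x by (simp add: card_Diff_subset)
  then obtain x3 where "nbs v - {x1, x2} = {x3}" by (rule card_1_singletonE)
  then have x3: "nbs v = {x1, x2, x3}" "x3 \<noteq> x1" "x3 \<noteq> x2" using x by blast+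
  have xV: "x1 \<in> V" "x2 \<in> V" "x3 \<in> V" "E v x1" "E v x2" "E v x3"
    using x3(1) unfolding nbs_def by blast+
  have xH: "x1 \<notin> H" "x2 \<notin> H" "x3 \<notin> H" "v \<notin> H" using x3(1) far_exc_D(5,6)[OF H] by blast+
  have HV: "H \<subseteq> V" using far_exc_D(4)[OF H] .
  have aH: "a \<in> H" "c \<in> H" "E b a" "E b c" using ac(1) unfolding nbs_def by blast+
  have b_ne: "b \<noteq> a" "b \<noteq> c" using aH E_irrefl by metis+
  have v_ne: "v \<noteq> x1" "v \<noteq> x2" "v \<noteq> x3" using xV E_irrefl by metis+
  have nbb: "insert b (nbs b) = {a, b, c, x2}"
  proof
    show "insert b (nbs b) \<subseteq> {a, b, c, x2}"
    proof
      fix w assume w: "w \<in> insert b (nbs b)"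
      show "w \<in> {a, b, c, x2}"
      proof (cases "w = b \<or> w \<in> H")
        case True then show ?thesis using w ac(1) by blast
      next
        case False
        then have "w \<in> nbs v" "E w b"
          using w far_exc_nbrs[OF H b, of w] attached_subset E_sym unfolding nbs_def by blast+
        then show ?thesis using xb by blast
      qed
    qed
    have "E b x2" using xb[OF x(2)] E_sym by blast
    then show "{a, b, c, x2} \<subseteq> insert b (nbs b)" using aH HV xV unfolding nbs_def by blast
  qed
  have inK: "x1 \<in> K" "x3 \<in> K"
    using closed_in_D[OF exc_components_D(1)[OF K(1)] K(2)] xV xH aH b x(3) x3(3) unfolding nbb
        by blast+
  have sub: "{v, a, c} \<subseteq> nbs x1" using v aH HV ac xV E_sym unfolding nbs_def by blast
  have "v \<noteq> a" "v \<noteq> c" using xH(4) aH by blast+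
  then have c3: "card {v, a, c} = 3" using ac(2) by simp
  then have nb1: "nbs x1 = {v, a, c}"
    using card_seteq[OF _ sub] degree_le_3[OF xV(1)] by simp
  have K1: "w = v" if "w \<in> K" "E x1 w" for w
    using that nb1 K(3) aH exc_components_D(4)[OF K(1)] unfolding nbs_def by blast
  \<comment> \<open>Within \<open>K\<close> the vertex \<open>x1\<close> has the single neighbour
    \<open>v\<close>, whereas each vertex of an exceptional cycle has two.\<close>
  have K3: "card K = 3"
  proof (rule exceptional_cases[OF exc_components_D(3)[OF K(1)]])
    fix m k assume "m = 7 \<or> m = 11" "cycle_on m k K"
    then obtain p q where "{w\<in>K. E x1 w} = {p, q}" "p \<noteq> q" using cycle_on_two_nbrs[OF _ _ inK(1)]
        by metis
    then show ?thesis using K1 by blast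
  qed
  have Keq: "K = {v, x1, x3}"
  proof -
    have "{v, x1, x3} \<subseteq> K" using K(2) inK by blast
    moreover have "card {v, x1, x3} = 3" using v_ne x3(2) by simp
    ultimately show ?thesis
      using card_seteq[of K "{v, x1, x3}"] exceptional_finite[OF exc_components_D(3)[OF K(1)]] K3
          by simp
  qed
  have x2b': "E x2 b" using xb x by blast
  \<comment> \<open>An edge from \<open>x3\<close> to \<open>x2\<close> would close the 6-cycle
    \<open>x1\<close>, \<open>a\<close>, \<open>b\<close>, \<open>x2\<close>, \<open>x3\<close>,
    \<open>v\<close>.\<close>
  have nb3: "w = v" if w: "w \<in> V" "E x3 w" for w
  proof (cases "w \<in> insert b (nbs b)")
    case True
    then consider "w \<in> H" | "w = x2" unfolding nbb using aH b by blast
    then show ?thesis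
    proof cases
      case 1
      then show ?thesis using only[of x3 w] w x3 by blast
    next
      case 2
      have "distinct [x1, a, b, x2, x3, v]" using xH aH b b_ne v_ne x3 x(3) by auto
      then show ?thesis
        using C6_free[of x1 a b x2 x3 v] xV v aH b HV ac(3) x2b' w(2) 2 E_sym by blast
    qed
  next
    case False
    then have "w \<in> K" using closed_in_D[OF exc_components_D(1)[OF K(1)] inK(2) w(2)] w(1) by blast
    moreover have "x3 \<notin> nbs x1" unfolding nb1 using xH(3) aH v_ne by auto
    then have "w \<noteq> x1" using w(2) xV E_sym unfolding nbs_def by blast
    moreover have "w \<noteq> x3" using w(2) E_irrefl by blast
    ultimately show ?thesis using Keq by blast
  qed
  let ?Y = "{x1, v, a, c, x3}"
  have left: "?Y - closed_nbhd {x1} \<subseteq> {x3}" using ac(3,4) xV(4) E_sym unfolding closed_nbhd_def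
      by blast
  have YV: "?Y \<subseteq> V" using xV v aH HV by blast
  have x3Y: "x1 \<in> ?Y" by blast
  have "card (?Y - closed_nbhd {x1}) \<le> card {x3}" using left by (intro card_mono) simp_all
  then have sp: "sparse (?Y - closed_nbhd {x1})" by (intro sparse_card_le_2) simp_all
  have free: "\<And>u w. u \<in> ?Y - closed_nbhd {x1} \<Longrightarrow> w \<in> V - ?Y \<Longrightarrow> \<not> E u w" using left nb3 by blast
  \<comment> \<open>For \<open>dominate_bound\<close>, \<open>x2\<close> takes the place of
    \<open>v\<close>. A component without \<open>x2\<close> is either in \<open>far_exc v\<close>
    with \<open>x2\<close> as its only attachment, or lies in \<open>H - N[b]\<close>, which is
    empty or has order 4 or 8.\<close>
  have C: "x2 \<in> C" if C: "C \<in> exc_components ?Y" for C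
  proof (rule ccontr)
    assume n: "x2 \<notin> C"
    have CV: "C \<subseteq> V - ?Y" using exc_components_D(4)[OF C] .
    have "x2 \<notin> ?Y" using xH(2) aH x(3) x3(3) v_ne by blast
    then have bC: "b \<notin> C" using closed_in_D[OF exc_components_D(1)[OF C], of b x2] n x2b' E_sym xV
        by blast
    have CN: "C \<subseteq> V - insert v (nbs v)" using CV n x3(1) by blast
    show False
    proof (cases "C \<inter> H = {}")
      case True
      have "closed_in (V - insert v (nbs v)) C"
        unfolding closed_in_def
      proof (intro conjI ballI notI)
        show "C \<subseteq> V - insert v (nbs v)" by fact
        fix u w assume uw: "u \<in> C" "w \<in> V - insert v (nbs v) - C" "E u w"
        then have "w \<in> ?Y" using closed_in_D[OF exc_components_D(1)[OF C]] by blast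
        then have "w \<in> H" using uw(2) aH x3(1) by blast
        then have "u \<in> H" using closed_in_D[OF far_exc_D(1)[OF H], of w u] uw CN E_sym by blast
        then show False using True uw by blast
      qed
      then have CH: "C \<in> far_exc v" unfolding far_exc_def using exc_components_D(3)[OF C]
          by (rule exc_components_I)
      have "attached C v \<subseteq> {x2}"
      proof
        fix z assume "z \<in> attached C v"
        then obtain u where z: "z \<in> nbs v" "u \<in> C" "E z u" unfolding attached_def by blast
        then have "u \<in> V" "u \<noteq> v" "u \<noteq> a" "u \<noteq> c" using CV by blast+
        then have "z \<noteq> x1" "z \<noteq> x3" using nb1 nb3 z(3) unfolding nbs_def by blast+
        then show "z \<in> {x2}" using z(1) x3(1) by blast
      qed
      then have "card (attached C v) \<le> card {x2}" by (intro card_mono) simp_all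
      then show False using card_attached[OF v CH] by simp
    next
      case False
      have CH: "C \<subseteq> H" using connected_set_subset_closed_in[OF exc_components_D(2)[OF C] CN
          far_exc_D(1)[OF H] False] .
      have dom_b: "u \<in> {a, b, c}" if "u \<in> closed_nbhd {b}" "u \<in> H" for u
        using that ac(1) HV unfolding closed_nbhd_def nbs_def by blast
      have CR: "C \<subseteq> H - closed_nbhd {b}" using CH bC CV dom_b by blast
      show False
      proof (rule exceptional_cases[OF far_exc_D(3)[OF H]])
        assume H3: "card H = 3"
        have "{a, b, c} \<subseteq> H" "card {a, b, c} = 3" using aH b b_ne ac(2) by auto
        then have "H = {a, b, c}"
          using card_seteq[of H "{a, b, c}"] H3 finite_subset_V[OF HV] by simp
        then have "H \<subseteq> closed_nbhd {b}" using aH unfolding closed_nbhd_def by blast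
        then show False using CR exc_components_D(5)[OF C] by blast
      next
        fix m k assume m: "m = 7 \<or> m = 11" "cycle_on m k H"
        have R: "connected_set (H - closed_nbhd {b})" "card (H - closed_nbhd {b}) \<in> {4, 8}"
            using cycle_on_remainder[OF m(2,1) b] .
        have "H - closed_nbhd {b} \<subseteq> V - ?Y" using HV xH aH unfolding closed_nbhd_def by blast
        moreover have "(H - closed_nbhd {b}) \<inter> C \<noteq> {}" using CR exc_components_D(5)[OF C] by blast
        ultimately have "H - closed_nbhd {b} \<subseteq> C"
            by (intro connected_set_subset_closed_in[OF R(1) _ exc_components_D(1)[OF C]])
        then have "C = H - closed_nbhd {b}" using CR by blast
        then show False using R(2) exceptional_card[OF exc_components_D(3)[OF C]] by auto
      qed
    qed
  qed
  have "card ?Y \<le> 4" using dominate_bound(1)[OF xV(2) YV x3Y sp free C] .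
  moreover have "card ?Y = 5"
    using v_ne x3 ac(2) xH aH by (simp add: card_insert_if) metis
  ultimately show False by simp
qed

text \<open>The vertex \<open>x2\<close> dominates \<open>b\<close> in \<open>H\<close> and
  \<open>v\<close> in \<open>K\<close>, so each of the two exceptional sets is handled with one
  vertex fewer. Taking \<open>x2\<close> together with both, \<open>D\<close> satisfies 4 |D| \<le>
  |H| + |K| - 2, while |Y| = |H| + |K| + 1.\<close>

lemma config_single_contra:
  assumes v: "v \<in> V" and d: "card (nbs v) = 3" and H: "H \<in> far_exc v" and c: "config v H b x1 x2 K"
    and ac: "nbs b \<inter> H = {a, c}" "a \<noteq> c" "\<not> E a c" "E x1 a" "\<And>y. y \<in> H \<Longrightarrow> E x1 y \<Longrightarrow> y = a"
  shows False
proof -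
  have K: "K \<in> exc_components (insert b (nbs b))" "v \<in> K" "K \<inter> H = {}" and b: "b \<in> H"
    and x: "x1 \<in> nbs v" "x2 \<in> nbs v" "x1 \<noteq> x2"
    and xb: "\<And>x. x \<in> nbs v \<Longrightarrow> E x b \<longleftrightarrow> x = x2"
    and only: "\<And>x y. x \<in> nbs v \<Longrightarrow> y \<in> H \<Longrightarrow> E x y \<Longrightarrow> x = x1 \<or> x = x2"
    using c unfolding config_def by blast+
  have "card (nbs v - {x1, x2}) = 1" using d x by (simp add: card_Diff_subset)
  then obtain x3 where "nbs v - {x1, x2} = {x3}" by (rule card_1_singletonE)
  then have x3: "nbs v = {x1, x2, x3}" "x3 \<noteq> x1" "x3 \<noteq> x2" using x by blast+
  have xV: "x1 \<in> V" "x2 \<in> V" "x3 \<in> V" "E v x1" "E v x2" "E v x3"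
    using x3(1) unfolding nbs_def by blast+
  have xH: "x1 \<notin> H" "x2 \<notin> H" "x3 \<notin> H" "v \<notin> H" using x3(1) far_exc_D(5,6)[OF H] by blast+
  have HV: "H \<subseteq> V" using far_exc_D(4)[OF H] .
  have aH: "a \<in> H" "c \<in> H" "E b a" "E b c" using ac(1) unfolding nbs_def by blast+
  have b_ne: "b \<noteq> a" "b \<noteq> c" using aH E_irrefl by metis+
  have v_ne: "v \<noteq> x1" "v \<noteq> x2" "v \<noteq> x3" using xV E_irrefl by metis+
  have x2b: "E x2 b" using xb x by blast
  have nbb: "insert b (nbs b) \<subseteq> insert x2 H"
  proof
    fix w assume w: "w \<in> insert b (nbs b)"
    show "w \<in> insert x2 H"
    proof (cases "w = b \<or> w \<in> H")
      case True then show ?thesis using b by blast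
    next
      case False
      then have "w \<in> nbs v" "E w b"
        using w far_exc_nbrs[OF H b, of w] attached_subset E_sym unfolding nbs_def by blast+
      then show ?thesis using xb by blast
    qed
  qed
  have x2nb: "x2 \<in> insert b (nbs b)" using x2b xV E_sym unfolding nbs_def by blast
  have KV: "K \<subseteq> V" "x2 \<notin> K" using exc_components_D(4)[OF K(1)] x2nb by blast+
  have inK: "x1 \<in> K" "x3 \<in> K"
    using closed_in_D[OF exc_components_D(1)[OF K(1)] K(2)] xV xH x(3) x3(3) nbb by blast+
  have exH: "exceptional H" and exK: "exceptional K"
      using far_exc_D(3)[OF H] exc_components_D(3)[OF K(1)] .
  have fin: "finite H" "finite K" using exceptional_finite exH exK by blast+
  have "\<forall>w\<in>H. E a w \<longrightarrow> w = b" if H3: "card H = 3"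
  proof -
    have "{a, b, c} \<subseteq> H" "card {a, b, c} = 3" using aH b b_ne ac(2) by auto
    then have "H = {a, b, c}" using card_seteq[of H "{a, b, c}"] H3 fin by simp
    then show ?thesis using ac(3) E_irrefl by blast
  qed
  then obtain DH where DH: "DH \<subseteq> H - {b}" "4 * card DH + 3 = card H"
      "sparse (H - {b} - closed_nbhd DH)"
    "\<forall>w\<in>H - {b} - closed_nbhd DH. \<not> E a w"
    using exceptional_delete_edge[OF exH b aH(1,3)] by blast
  have "\<forall>w\<in>K. E x1 w \<longrightarrow> w = v" if K3: "card K = 3"
  proof -
    have "{v, x1, x3} \<subseteq> K" "card {v, x1, x3} = 3" using K(2) inK v_ne x3(2) by auto
    then have Keq: "K = {v, x1, x3}" using card_seteq[of K "{v, x1, x3}"] K3 fin by simp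
    \<comment> \<open>Otherwise \<open>v\<close>, \<open>x3\<close>, \<open>x1\<close>,
      \<open>a\<close>, \<open>b\<close>, \<open>x2\<close> is a 6-cycle.\<close>
    have "\<not> E x3 x1"
    proof
      assume e: "E x3 x1"
      have "distinct [v, x3, x1, a, b, x2]" using xH aH b b_ne v_ne x3 x(3) by auto
      then show False
        using C6_free[of v x3 x1 a b x2] xV v aH b HV ac(4) x2b e E_sym by blast
    qed
    then show ?thesis using Keq E_sym E_irrefl by blast
  qed
  then obtain DK where DK: "DK \<subseteq> K - {v}" "4 * card DK + 3 = card K"
      "sparse (K - {v} - closed_nbhd DK)"
    "\<forall>w\<in>K - {v} - closed_nbhd DK. \<not> E x1 w"
    using exceptional_delete_edge[OF exK K(2) inK(1) xV(4)] by blast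
  let ?Y = "insert x2 (H \<union> K)"
  let ?D = "insert x2 (DH \<union> DK)"
  let ?LH = "H - {b} - closed_nbhd DH" and ?LK = "K - {v} - closed_nbhd DK"
  have left: "?Y - closed_nbhd ?D \<subseteq> ?LH \<union> ?LK"
    using x2b xV(5) E_sym unfolding closed_nbhd_def by blast
  \<comment> \<open>The only edge between \<open>H\<close> and \<open>K\<close> joins
    \<open>a\<close> to \<open>x1\<close>. Both ends have no further undominated neighbour by the
    choice of \<open>DH\<close> and \<open>DK\<close>, so the edge does no harm.\<close>
  have HK: "u = a \<and> w = x1" if "u \<in> H" "w \<in> K" "E u w" for u w
  proof -
    have "w \<in> nbs v" using far_exc_nbrs[OF H that(1,3)] that(2) KV K(3) attached_subset by blast
    then have "w = x1" using only[of w u] that KV E_sym by blast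
    then show ?thesis using ac(5)[of u] that E_sym by blast
  qed
  have sp: "sparse (?Y - closed_nbhd ?D)"
  proof (rule sparse_subset[OF _ left], unfold sparse_def, intro ballI impI)
    fix u w w' assume u: "u \<in> ?LH \<union> ?LK" "w \<in> ?LH \<union> ?LK" "w' \<in> ?LH \<union> ?LK" "E u w" "E u w'"
    consider "u = a" "u \<in> ?LH" | "u \<noteq> a" "u \<in> ?LH" | "u = x1" "u \<in> ?LK" | "u \<noteq> x1" "u \<in> ?LK"
        using u(1) by blast
    then show "w = w'"
    proof cases
      case 1
      then have "w \<in> K" "w' \<in> K" using DH(4) u by blast+
      then show ?thesis using HK 1 u aH by blast
    next
      case 2
      then have "w \<notin> K" "w' \<notin> K" using HK u by blast+
      then show ?thesis using DH(3) 2 u unfolding sparse_def by blast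
    next
      case 3
      then have "w \<in> H" "w' \<in> H" using DK(4) u by blast+
      then show ?thesis using ac(5) 3 u by blast
    next
      case 4
      then have "w \<notin> H" "w' \<notin> H" using HK u E_sym by blast+
      then show ?thesis using DK(3) 4 u unfolding sparse_def by blast
    qed
  qed
  have free: "\<not> E u w" if u: "u \<in> ?Y - closed_nbhd ?D" and w: "w \<in> V - ?Y" for u w
  proof
    assume e: "E u w"
    have "u \<in> H \<or> u \<in> K" using left u by blast
    then show False
    proof
      assume uH: "u \<in> H"
      have "w \<in> attached H v" using far_exc_nbrs[OF H uH e] w by blast
      then have "w = x1 \<or> w = x2" using only[of w u] e uH E_sym attached_subset by blast
      then show False using w inK by blast
    next
      assume "u \<in> K"
      then show False using closed_in_D[OF exc_components_D(1)[OF K(1)] _ e] w nbb by blast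
    qed
  qed
  have YV: "?Y \<subseteq> V" using HV KV xV by blast
  \<comment> \<open>Such a component would belong to \<open>far_exc v\<close> with \<open>x2\<close>
    as its only attachment.\<close>
  have no: "exc_components ?Y = {}"
  proof (rule ccontr)
    assume "exc_components ?Y \<noteq> {}"
    then obtain C where C: "C \<in> exc_components ?Y" by blast
    have CV: "C \<subseteq> V - ?Y" using exc_components_D(4)[OF C] .
    have CN: "C \<subseteq> V - insert v (nbs v)" unfolding x3(1) using CV K(2) inK by auto
    have notK: "\<not> E u w" if "u \<in> C" "w \<in> K" for u w
    proof
      assume "E u w"
      moreover have "u \<in> V - insert b (nbs b)" using that CV nbb by blast
      ultimately have "u \<in> K" using closed_in_D[OF exc_components_D(1)[OF K(1)] that(2)] E_sym
          by blast
      then show False using that CV by blast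
    qed
    have "closed_in (V - insert v (nbs v)) C"
      unfolding closed_in_def
    proof (intro conjI ballI notI)
      show "C \<subseteq> V - insert v (nbs v)" by fact
      fix u w assume uw: "u \<in> C" "w \<in> V - insert v (nbs v) - C" "E u w"
      then have "w \<in> ?Y" using closed_in_D[OF exc_components_D(1)[OF C]] by blast
      then have "w \<in> H" using uw notK x(2) by blast
      then have "u \<in> H" using closed_in_D[OF far_exc_D(1)[OF H], of w u] uw CN E_sym by blast
      then show False using CV uw by blast
    qed
    then have CH: "C \<in> far_exc v" unfolding far_exc_def using exc_components_D(3)[OF C]
        by (rule exc_components_I)
    have "attached C v \<subseteq> {x2}"
    proof
      fix z assume "z \<in> attached C v"
      then obtain u where z: "z \<in> nbs v" "u \<in> C" "E z u" unfolding attached_def by blast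
      then have "z \<notin> K" using notK E_sym by blast
      then show "z \<in> {x2}" using z(1) inK unfolding x3(1) by auto
    qed
    then have "card (attached C v) \<le> card {x2}" by (intro card_mono) simp_all
    then show False using card_attached[OF v CH] by simp
  qed
  have "?D \<subseteq> ?Y" "?Y \<noteq> {}" using DH DK by blast+
  then have red: "card ?Y + 1 \<le> 4 * card ?D"
    using reduce[OF YV _ _ sp free] no by simp
  have "finite DH" "finite DK" using fin DH(1) DK(1) by (meson finite_Diff finite_subset)+
  then have "card ?D \<le> Suc (card DH + card DK)"
    using card_Un_le[of DH DK] card_insert_le_m1[of "Suc (card DH + card DK)" "DH \<union> DK" x2] by simp
  moreover have "card ?Y = Suc (card H + card K)"
  proof -
    have "card (H \<union> K) = card H + card K" using fin K(3) by (intro card_Un_disjoint) auto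
    then show ?thesis using fin xH(2) KV(2) by simp
  qed
  ultimately show False using red DH(2) DK(2) by linarith
qed

lemma degree_le_2:
  assumes v: "v \<in> V"
  shows "card (nbs v) \<le> 2"
proof (rule ccontr)
  assume "\<not> card (nbs v) \<le> 2"
  then have d: "card (nbs v) = 3" using degree_le_3[OF v] by simp
  then obtain H b x1 x2 K where H: "H \<in> far_exc v" and c: "config v H b x1 x2 K"
    using config_exists[OF v] by fastforce
  then have c': "\<exists>a c. nbs b \<inter> H = {a, c} \<and> a \<noteq> c \<and> \<not> E a c"
    "\<exists>y\<in>H. E x1 y" "\<forall>y\<in>H. E x1 y \<longrightarrow> E b y"
    unfolding config_def by blast+
  obtain a z where az: "nbs b \<inter> H = {a, z}" "a \<noteq> z" "\<not> E a z" using c'(1) by blast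
  have x1: "y = a \<or> y = z" if "y \<in> H" "E x1 y" for y
    using c'(3) that az(1) far_exc_D(4)[OF H] unfolding nbs_def by blast
  consider "E x1 a" "E x1 z" | "E x1 a" "\<not> E x1 z" | "E x1 z" "\<not> E x1 a" using c'(2) x1 by blast
  then show False
  proof cases
    case 1
    then show False using config_double_contra[OF v d H c az(1,2)] by blast
  next
    case 2
    then show False using config_single_contra[OF v d H c az 2(1)] x1 by blast
  next
    case 3
    have "nbs b \<inter> H = {z, a}" "z \<noteq> a" "\<not> E z a" using az E_sym by blast+
    then show False using config_single_contra[OF v d H c _ _ _ 3(1)] x1 3(2) by blast
  qed
qed

end

subsection \<open>Maximum degree two\<close>

context simple_rel
begin

text \<open>In a longest path the inner vertices have both their neighbours on the path, and the
  ends have none outside it by maximality. So its vertex set is closed and equals \<open>S\<close>,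
  and only the two ends can be adjacent without being consecutive.\<close>

lemma hamiltonian_path:
  assumes fin: "finite S" and connected_set: "connected_set S" and deg: "\<And>v. v \<in> S
      \<Longrightarrow> card {w\<in>S. E v w} \<le> 2"
  obtains p where "set p = S" "distinct p" "\<And>i. Suc i < length p \<Longrightarrow> E (p ! i) (p ! Suc i)"
    "\<And>i j. i < length p \<Longrightarrow> j < length p \<Longrightarrow> E (p ! i) (p ! j) \<Longrightarrow>
       j = Suc i \<or> i = Suc j \<or> i = 0 \<and> Suc j = length p \<or> j = 0 \<and> Suc i = length p"
proof -
  define P where "P p \<longleftrightarrow> distinct p \<and> set p \<subseteq> S
      \<and> (\<forall>i. Suc i < length p \<longrightarrow> E (p ! i) (p ! Suc i))" for p
  obtain s where s: "s \<in> S" using connected_set unfolding connected_set_def by blast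
  have Ps: "P [s]" using s unfolding P_def by simp
  have "length q < Suc (card S)" if "P q" for q
    using that card_mono[OF fin, of "set q"] distinct_card[of q] unfolding P_def by fastforce
  then obtain p where p: "P p" and max: "\<And>q. P q \<Longrightarrow> length q \<le> length p"
    using ex_has_greatest_nat[of P "[s]" length "Suc (card S)"] Ps by (metis less_imp_le)
  have pd: "distinct p" and pS: "set p \<subseteq> S" and step: "\<And>i. Suc i < length p \<Longrightarrow> E (p ! i) (p ! Suc i)"
    using p unfolding P_def by blast+
  have len: "length p \<ge> 1" using max[OF Ps] by simp
  define n where "n = length p"
  have eq: "p ! i = p ! j \<longleftrightarrow> i = j" if "i < n" "j < n" for i j
    using that pd unfolding n_def by (simp add: nth_eq_iff_index_eq)
  have in_S: "p ! i \<in> S" if "i < n" for i using that pS unfolding n_def by auto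
  have inner: "w = p ! (i - 1) \<or> w = p ! Suc i" if i: "0 < i" "Suc i < n" and w: "w \<in> S"
      "E (p ! i) w" for i w
  proof -
    have sub: "{p ! (i - 1), p ! Suc i} \<subseteq> {w\<in>S. E (p ! i) w}"
      using step[of i] step[of "i - 1"] i in_S E_sym unfolding n_def by auto
    have "card {p ! (i - 1), p ! Suc i} = 2" using eq[of "i - 1" "Suc i"] i by simp
    then have "{p ! (i - 1), p ! Suc i} = {w\<in>S. E (p ! i) w}"
      using card_seteq[OF _ sub] deg[OF in_S[of i]] fin i by simp
    then show ?thesis using w by blast
  qed
  have first: "w \<in> set p" if w: "w \<in> S" "E (p ! 0) w" for w
  proof (rule ccontr)
    assume n: "w \<notin> set p"
    have "E ((w # p) ! i) ((w # p) ! Suc i)" if "Suc i < length (w # p)" for i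
      using that step w E_sym by (cases i) auto
    then have "P (w # p)" using pd pS n w unfolding P_def by simp
    then show False using max by fastforce
  qed
  have last: "w \<in> set p" if w: "w \<in> S" "E (p ! (n - 1)) w" for w
  proof (rule ccontr)
    assume nw: "w \<notin> set p"
    have "E ((p @ [w]) ! i) ((p @ [w]) ! Suc i)" if "Suc i < length (p @ [w])" for i
    proof (cases "Suc i < n")
      case True
      then show ?thesis using step[of i] unfolding n_def by (simp add: nth_append)
    next
      case False
      then have "i = n - 1" "Suc i = n" using that unfolding n_def by auto
      then show ?thesis using w(2) len unfolding n_def by (simp add: nth_append)
    qed
    then have "P (p @ [w])" using pd pS nw w unfolding P_def by simp
    then show False using max by fastforce
  qed
  have nbr: "w \<in> set p" if "i < n" "w \<in> S" "E (p ! i) w" for i w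
  proof -
    have "i = 0 \<or> i = n - 1 \<or> 0 < i \<and> Suc i < n" using that(1) by arith
    then consider "i = 0" | "i = n - 1" | "0 < i" "Suc i < n" by blast
    then show ?thesis
    proof cases
      case 1 then show ?thesis using first that by blast
    next
      case 2 then show ?thesis using last that by blast
    next
      case 3 then show ?thesis using inner[OF 3 that(2,3)] unfolding n_def by auto
    qed
  qed
  have "closed_in S (set p)"
    unfolding closed_in_def using pS nbr by (metis DiffD1 DiffD2 in_set_conv_nth n_def)
  then have set: "set p = S" using connected_set len unfolding connected_set_def by fastforce
  have adj: "j = Suc i \<or> i = Suc j" if "0 < i" "Suc i < n" "j < n" "E (p ! i) (p ! j)" for i j
  proof -
    have "p ! j = p ! (i - 1) \<or> p ! j = p ! Suc i"
        using inner[OF that(1,2) in_S[OF that(3)] that(4)] .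
    then have "j = i - 1 \<or> j = Suc i" using eq[of j "i - 1"] eq[of j "Suc i"] that by auto
    then show ?thesis using that(1) by auto
  qed
  have "j = Suc i \<or> i = Suc j \<or> i = 0 \<and> Suc j = n \<or> j = 0 \<and> Suc i = n"
    if ij: "i < n" "j < n" "E (p ! i) (p ! j)" for i j
  proof -
    have "i \<noteq> j" using ij E_irrefl by auto
    then consider "0 < i" "Suc i < n" | "0 < j" "Suc j < n" | "i = 0" "Suc j = n" | "j = 0"
        "Suc i = n"
      using ij by linarith
    then show ?thesis
    proof cases
      case 1 then show ?thesis using adj[OF 1 ij(2,3)] by blast
    next
      case 2 then show ?thesis using adj[OF 2 ij(1)] ij(3) E_sym by blast
    qed auto
  qed
  then show ?thesis using that[OF set pd step] unfolding n_def by blast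
qed

section \<open>Isolating sets of paths and cycles by residues modulo five\<close>

lemma card_residue: "card {i. i < n \<and> i mod 5 = r} \<le> (n + 4 - r) div 5" if "r < 5" for r n :: nat
proof -
  \<comment> \<open>The bound is (n - r) / 5 rounded up. As \<open>r < 5\<close>, the subtraction in
    \<open>n + 4 - r\<close> does not truncate.\<close>
  have "{i. i < n \<and> i mod 5 = r} \<subseteq> (\<lambda>j. 5 * j + r) ` {..<(n + 4 - r) div 5}"
  proof
    fix i assume "i \<in> {i. i < n \<and> i mod 5 = r}"
    then have "i < n" "i = 5 * (i div 5) + r" using mult_div_mod_eq[of 5 i] by auto
    then obtain q where i: "i = 5 * q + r" "5 * q + r < n" by metis
    then have "5 * (q + 1) + r \<le> n + 4" by simp
    then have "5 * (q + 1) \<le> n + 4 - r" by (rule add_le_imp_le_diff)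
    then have "(5 * (q + 1)) div 5 \<le> (n + 4 - r) div 5" by (rule div_le_mono)
    then have "q < (n + 4 - r) div 5" by simp
    then show "i \<in> (\<lambda>j. 5 * j + r) ` {..<(n + 4 - r) div 5}" using i(1) by blast
  qed
  then have "card {i. i < n \<and> i mod 5 = r} \<le> card ((\<lambda>j. 5 * j + r) ` {..<(n + 4 - r) div 5})"
    by (intro card_mono) simp_all
  also have "\<dots> \<le> (n + 4 - r) div 5" using card_image_le[of "{..<(n + 4 - r) div 5}" "\<lambda>j. 5 * j + r"]
      by simp
  finally show ?thesis .
qed

text \<open>This reduces isolation to index arithmetic: \<open>L\<close> is any set that contains
  all undominated indices and has no index with two neighbours in it.\<close>

lemma isolates_indices:
  fixes I :: "nat set" and p :: "'a list"
  assumes p: "set p = S" and I: "I \<subseteq> {..<length p}"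
    and L: "\<And>i. i < length p \<Longrightarrow> i \<notin> I \<Longrightarrow> \<forall>l\<in>I. \<not> E (p ! l) (p ! i) \<Longrightarrow> i \<in> L"
    and sp: "\<forall>i\<in>L. \<forall>j\<in>L. \<forall>k\<in>L. E (p ! i) (p ! j) \<longrightarrow> E (p ! i) (p ! k) \<longrightarrow> j = k"
  shows "isolates S ((!) p ` I)" "card ((!) p ` I) \<le> card I"
proof -
  have left: "S - closed_nbhd ((!) p ` I) \<subseteq> (!) p ` L"
  proof
    fix u assume u: "u \<in> S - closed_nbhd ((!) p ` I)"
    then obtain i where i: "i < length p" "u = p ! i" using p by (metis DiffD1 in_set_conv_nth)
    have "i \<notin> I" "\<forall>l\<in>I. \<not> E (p ! l) (p ! i)" using u unfolding closed_nbhd_def i(2) by blast+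
    then show "u \<in> (!) p ` L" using L[OF i(1)] i(2) by blast
  qed
  have "sparse ((!) p ` L)"
    unfolding sparse_def
  proof (intro ballI impI)
    fix u w w' assume c: "u \<in> (!) p ` L" "w \<in> (!) p ` L" "w' \<in> (!) p ` L" "E u w" "E u w'"
    then obtain i j k where "u = p ! i" "w = p ! j" "w' = p ! k" "i \<in> L" "j \<in> L" "k \<in> L"
        by (elim imageE)
    then show "w = w'" using sp c(4,5) by blast
  qed
  then have "sparse (S - closed_nbhd ((!) p ` I))" using left by (rule sparse_subset)
  moreover have "(!) p ` I \<subseteq> S"
  proof (rule image_subsetI)
    fix i assume "i \<in> I"
    then show "p ! i \<in> S" using I p nth_mem by blast
  qed
  ultimately show "isolates S ((!) p ` I)" unfolding isolates_def by simp
  have "finite I" using I by (rule finite_subset) simp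
  then show "card ((!) p ` I) \<le> card I" by (rule card_image_le)
qed

text \<open>The list of vertices around the cycle is extended periodically by reducing integer
  indices modulo \<open>m\<close>.\<close>

lemma cycle_on_of_list:
  assumes p: "set p = S" "distinct p" and m: "length p = nat m" "m = 7 \<or> m = 11"
    and E: "\<And>i j. i < length p \<Longrightarrow> j < length p \<Longrightarrow> E (p ! i) (p ! j) \<longleftrightarrow>
       j = Suc i \<or> i = Suc j \<or> i = 0 \<and> Suc j = length p \<or> j = 0 \<and> Suc i = length p"
  shows "cycle_on m (\<lambda>i. p ! nat (i mod m)) S"
proof -
  have m0: "m > 0" using m by auto
  have lt: "nat (i mod m) < length p" for i using m0 m(1) by (simp add: nat_less_eq_zless)
  have "S = (\<lambda>i. p ! nat (i mod m)) ` {0..<m}"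
  proof
    show "S \<subseteq> (\<lambda>i. p ! nat (i mod m)) ` {0..<m}"
    proof
      fix u assume "u \<in> S"
      then obtain i where i: "i < length p" "u = p ! i" using p(1) by (metis in_set_conv_nth)
      then have "u = p ! nat (int i mod m)" "int i \<in> {0..<m}" using m m0 by auto
      then show "u \<in> (\<lambda>i. p ! nat (i mod m)) ` {0..<m}" by blast
    qed
    show "(\<lambda>i. p ! nat (i mod m)) ` {0..<m} \<subseteq> S" unfolding p(1)[symmetric] using lt nth_mem by blast
  qed
  moreover have "p ! nat (i mod m) = p ! nat (j mod m) \<longleftrightarrow> m dvd i - j" for i j
  proof -
    have "p ! nat (i mod m) = p ! nat (j mod m) \<longleftrightarrow> nat (i mod m) = nat (j mod m)"
      using lt p(2) by (simp add: nth_eq_iff_index_eq)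
    also have "\<dots> \<longleftrightarrow> i mod m = j mod m" using m0 by (simp add: eq_nat_nat_iff)
    finally show ?thesis by (simp add: mod_eq_dvd_iff)
  qed
  moreover have "E (p ! nat (i mod m)) (p ! nat (j mod m)) \<longleftrightarrow> m dvd i - j - 1
      \<or> m dvd i - j + 1" for i j
  proof -
    define a b where "a = nat (i mod m)" and "b = nat (j mod m)"
    have ab: "i mod m = int a" "j mod m = int b" "int a < m" "int b < m"
      using m0 unfolding a_def b_def by simp_all
    have "m dvd i - j + c \<longleftrightarrow> m dvd int a - int b + c" for c
    proof -
      have "m dvd (i - i mod m) - (j - j mod m)" by (rule dvd_diff[OF dvd_minus_mod dvd_minus_mod])
      then have "m dvd (i - j + c) - (i mod m - j mod m + c)" by (simp add: algebra_simps)
      then have "(i - j + c) mod m = (i mod m - j mod m + c) mod m" by (simp only: mod_eq_dvd_iff)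
      then show ?thesis unfolding ab(1,2) dvd_eq_mod_eq_0 by (simp only:)
    qed
    from this[of "- 1"] this[of 1]
    have d: "m dvd i - j - 1 \<longleftrightarrow> m dvd int a - int b - 1" "m dvd i - j + 1 \<longleftrightarrow> m dvd int a - int b + 1"
      by simp_all
    have "E (p ! a) (p ! b) \<longleftrightarrow> b = Suc a \<or> a = Suc b \<or> a = 0 \<and> Suc b = nat m \<or> b = 0 \<and> Suc a = nat m"
      using E[of a b] lt[of i] lt[of j] m(1) unfolding a_def b_def by simp
    also have "\<dots> \<longleftrightarrow> m dvd int a - int b - 1 \<or> m dvd int a - int b + 1"
    proof -
      \<comment> \<open>In this range the only multiples are 0 and \<open>- m\<close>. They
        correspond to consecutive indices and to the step between the last and the first
        index.\<close>
      have dvd: "m dvd x \<longleftrightarrow> x = 0 \<or> x = - m" if "- m \<le> x" "x < m" for x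
        using that m0 zdvd_not_zless[of x m] zdvd_not_zless[of "- x" m] by fastforce
      have 1: "m dvd int a - int b - 1 \<longleftrightarrow> int a = int b + 1 \<or> int a = 0 \<and> int b + 1 = m"
        using dvd[of "int a - int b - 1"] ab(3,4) by linarith
      have "m dvd int a - int b + 1 \<longleftrightarrow> m dvd int b - int a - 1"
        using dvd_minus_iff[of m "int a - int b + 1"] by (simp add: algebra_simps)
      then have 2: "m dvd int a - int b + 1 \<longleftrightarrow> int b = int a + 1 \<or> int b = 0 \<and> int a + 1 = m"
        using dvd[of "int b - int a - 1"] ab(3,4) by linarith
      show ?thesis unfolding 1 2 using m0 by auto
    qed
    finally show ?thesis unfolding d a_def b_def .
  qed
  ultimately show ?thesis unfolding cycle_on_def by blast
qed

text \<open>Indices 3 modulo 5 dominate residues 2, 3, 4 and leave pairs with residues 0, 1. If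
  \<open>n mod 5 = 3\<close>, the last three indices would remain as a path, so \<open>n - 1\<close>
  is added; this is affordable except for \<open>n = 3\<close>.\<close>

lemma isolating_path:
  assumes p: "set p = S" "distinct p" and n: "length p \<noteq> 3"
    and E: "\<And>i j. i < length p \<Longrightarrow> j < length p \<Longrightarrow> E (p ! i) (p ! j) \<longleftrightarrow> j = Suc i \<or> i = Suc j"
  shows "\<exists>D. isolates S D \<and> 4 * card D \<le> card S"
proof -
  define n where "n = length p"
  define I where "I = {i. i < n \<and> i mod 5 = 3} \<union> (if n mod 5 = 3 then {n - 1} else {})"
  have I: "i \<in> I \<longleftrightarrow> i < n \<and> (i mod 5 = 3 \<or> n mod 5 = 3 \<and> Suc i = n)" for i
    unfolding I_def by auto
  have "card I \<le> card {i. i < n \<and> i mod 5 = 3} + (if n mod 5 = 3 then 1 else 0)"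
    unfolding I_def using card_Un_le[of "{i. i < n \<and> i mod 5 = 3}"
        "if n mod 5 = 3 then {n - 1} else {}"]
    by (auto split: if_splits)
  also have "\<dots> \<le> (n + 1) div 5 + (if n mod 5 = 3 then 1 else 0)"
    using card_residue[of 3 n] by simp
  also have "4 * \<dots> \<le> n"
  proof (cases "n mod 5 = 3")
    case True
    obtain q where q: "n = 5 * q + 3" using True mult_div_mod_eq[of 5 n] by metis
    then have "q \<ge> 1" using n unfolding n_def[symmetric] by (cases q) auto
    moreover have "(n + 1) div 5 = q" unfolding q by simp
    ultimately have "4 * ((n + 1) div 5 + 1) \<le> n" using q by simp
    then show ?thesis using True by simp
  next
    case False
    then show ?thesis by simp
  qed
  finally have card: "4 * card I \<le> n" by simp
  define L where "L = {l. l < n \<and> l \<notin> I \<and> Suc l \<notin> I \<and> (0 < l \<longrightarrow> l - 1 \<notin> I)}"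
  have L: "l \<in> L" if l: "l < length p" "l \<notin> I" "\<forall>x\<in>I. \<not> E (p ! x) (p ! l)" for l
  proof -
    have far: "x \<noteq> Suc l \<and> l \<noteq> Suc x" if "x \<in> I" for x
    proof -
      have "x < length p" using that unfolding I n_def by simp
      then show ?thesis using E[of x l] l that by metis
    qed
    have "Suc l \<notin> I" using far by blast
    moreover have "l - 1 \<notin> I" if "l > 0" using far[of "l - 1"] that by auto
    ultimately show ?thesis using l(1,2) unfolding L_def n_def by simp
  qed
  \<comment> \<open>Two distinct neighbours of an index lie on either side of it, so it suffices
    that \<open>L\<close> has no three consecutive indices.\<close>
  have gap: False if h: "i \<in> L" "Suc i \<in> L" "Suc (Suc i) \<in> L" for i
  proof -
    have not3: "l mod 5 \<noteq> 3" if "l \<in> L" for l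
      using that I[of l] unfolding L_def by blast
    have lt: "Suc (Suc i) < n" "Suc (Suc i) \<notin> I" "Suc (Suc (Suc i)) \<notin> I" "0 < i \<Longrightarrow> i - 1 \<notin> I"
      using h(1,3) unfolding L_def by blast+
    have "i mod 5 \<noteq> 3" "Suc i mod 5 \<noteq> 3" "Suc (Suc i) mod 5 \<noteq> 3"
      by (rule not3, rule h)+
    then have "i mod 5 = 0 \<or> i mod 5 = 4" by (auto simp: mod_Suc split: if_splits)
    then consider "i mod 5 = 0" | "i mod 5 = 4" by (elim disjE)
    then show False
    proof cases
      case 1
      then have m: "Suc (Suc (Suc i)) mod 5 = 3" by presburger
      then have "n = Suc (Suc (Suc i))" using lt(1,3) unfolding I by simp
      then show False using lt(2) m unfolding I by simp
    next
      case 2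
      then obtain k where k: "i = Suc k" by (cases i) auto
      then have "k mod 5 = 3" using 2 by (simp add: mod_Suc split: if_splits)
      then show False using lt(1,4) k unfolding I by simp
    qed
  qed
  have sp: "j = k" if h: "i \<in> L" "j \<in> L" "k \<in> L" "E (p ! i) (p ! j)" "E (p ! i) (p ! k)" for i j k
  proof (rule ccontr)
    assume "j \<noteq> k"
    moreover have "i < length p" "j < length p" "k < length p" using h(1-3) unfolding L_def n_def
        by blast+
    then have "j = Suc i \<or> i = Suc j" "k = Suc i \<or> i = Suc k" using E h(4,5) by blast+
    ultimately have "i = Suc j \<and> k = Suc (Suc j) \<or> i = Suc k \<and> j = Suc (Suc k)" by auto
    then consider "i = Suc j" "k = Suc (Suc j)" | "i = Suc k" "j = Suc (Suc k)" by blast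
    then show False
    proof cases
      case 1 then show False using gap[of j] h by blast
    next
      case 2 then show False using gap[of k] h by blast
    qed
  qed
  have "I \<subseteq> {..<length p}" unfolding I_def n_def by auto
  moreover have "\<forall>i\<in>L. \<forall>j\<in>L. \<forall>k\<in>L. E (p ! i) (p ! j) \<longrightarrow> E (p ! i) (p ! k) \<longrightarrow> j = k"
    using sp by blast
  ultimately have isolates: "isolates S ((!) p ` I)" "card ((!) p ` I) \<le> card I"
    using isolates_indices[OF p(1) _ L] by blast+
  have "n = card S" using p distinct_card unfolding n_def by metis
  then show ?thesis using isolates card by (intro exI[of _ "(!) p ` I"]) linarith
qed

text \<open>Indices 0 modulo 5 leave only residues 2 and 3. Four times n / 5 rounded up is at most
  \<open>n\<close> except for the positive lengths 1, 2, 3, 6, 7, 11; from 16 on this is a general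
  estimate.\<close>

lemma isolating_cycle:
  assumes p: "set p = S" "distinct p" and n: "length p \<notin> {0, 1, 2, 3, 6, 7, 11}"
    and E: "\<And>i j. i < length p \<Longrightarrow> j < length p \<Longrightarrow> E (p ! i) (p ! j) \<longleftrightarrow>
       j = Suc i \<or> i = Suc j \<or> i = 0 \<and> Suc j = length p \<or> j = 0 \<and> Suc i = length p"
  shows "\<exists>D. isolates S D \<and> 4 * card D \<le> card S"
proof -
  define n where "n = length p"
  define I where "I = {i. i < n \<and> i mod 5 = 0}"
  have I: "i \<in> I \<longleftrightarrow> i < n \<and> i mod 5 = 0" for i unfolding I_def by auto
  have "card I \<le> (n + 4) div 5" using card_residue[of 0 n] unfolding I_def by simp
  moreover have "4 * ((n + 4) div 5) \<le> n"
  proof (cases "n \<ge> 16")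
    case True
    have "5 * ((n + 4) div 5) \<le> n + 4" by simp
    then show ?thesis using True by linarith
  next
    case False
    then have "n \<in> {4, 5, 8, 9, 10, 12, 13, 14, 15}"
      using n unfolding n_def[symmetric] by (auto simp: eval_nat_numeral less_Suc_eq not_le)
    then show ?thesis by auto
  qed
  ultimately have card: "4 * card I \<le> n" by linarith
  define L where "L = {l. 0 < l \<and> l < n \<and> (l mod 5 = 2 \<or> l mod 5 = 3)}"
  have L: "l \<in> L" if l: "l < length p" "l \<notin> I" "\<forall>x\<in>I. \<not> E (p ! x) (p ! l)" for l
  proof -
    have ln: "l < n" using l(1) unfolding n_def .
    have l0: "0 < l" using ln l(2) unfolding I by (metis gr0I mod_0)
    have far: "x \<noteq> Suc l \<and> l \<noteq> Suc x \<and> \<not> (x = 0 \<and> Suc l = n)" if "x \<in> I" for x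
    proof -
      have "x < length p" using that unfolding I n_def by simp
      then show ?thesis using E[of x l] l that unfolding n_def by metis
    qed
    have "0 \<in> I" using ln unfolding I by simp
    \<comment> \<open>The last index is adjacent to 0 and therefore dominated, whatever its
      residue.\<close>
    then have "Suc l < n" using far[of 0] ln by auto
    moreover have "Suc l \<notin> I" using far by blast
    moreover have "l - 1 \<notin> I" using far[of "l - 1"] l0 by auto
    ultimately have "Suc l mod 5 \<noteq> 0" "(l - 1) mod 5 \<noteq> 0" "l mod 5 \<noteq> 0"
      using l(2) ln I[of l] I[of "Suc l"] I[of "l - 1"] by auto
    then have "l mod 5 = 2 \<or> l mod 5 = 3" using l0 by presburger
    then show ?thesis using l0 ln unfolding L_def by simp
  qed
  have sp: "j = k" if h: "i \<in> L" "j \<in> L" "k \<in> L" "E (p ! i) (p ! j)" "E (p ! i) (p ! k)" for i j k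
  proof -
    have "i < length p" "j < length p" "k < length p" "0 < i" "0 < j" "0 < k"
      using h(1-3) unfolding L_def n_def by blast+
    then have "j = Suc i \<or> i = Suc j" "k = Suc i \<or> i = Suc k" using E h(4,5) by auto
    moreover have "i mod 5 = 2 \<or> i mod 5 = 3" "j mod 5 = 2 \<or> j mod 5 = 3" "k mod 5 = 2
        \<or> k mod 5 = 3"
      using h(1-3) unfolding L_def by blast+
    ultimately show ?thesis by (auto simp: mod_Suc split: if_splits)
  qed
  have "I \<subseteq> {..<length p}" unfolding I_def n_def by auto
  moreover have "\<forall>i\<in>L. \<forall>j\<in>L. \<forall>k\<in>L. E (p ! i) (p ! j) \<longrightarrow> E (p ! i) (p ! k) \<longrightarrow> j = k"
    using sp by blast
  ultimately have isolates: "isolates S ((!) p ` I)" "card ((!) p ` I) \<le> card I"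
    using isolates_indices[OF p(1) _ L] by blast+
  have "n = card S" using p distinct_card unfolding n_def by metis
  then show ?thesis using isolates card by (intro exI[of _ "(!) p ` I"]) linarith
qed

end

section \<open>Conclusion of the induction\<close>

lemma (in minimal_counterexample) contradiction: False
proof -
  have deg: "card {w\<in>V. E v w} \<le> 2" if "v \<in> V" for v
    using degree_le_2[OF that] unfolding nbs_def .
  obtain p where p: "set p = V" "distinct p" and step: "\<And>i. Suc i < length p
      \<Longrightarrow> E (p ! i) (p ! Suc i)"
    and adj: "\<And>i j. i < length p \<Longrightarrow> j < length p \<Longrightarrow> E (p ! i) (p ! j) \<Longrightarrow>
       j = Suc i \<or> i = Suc j \<or> i = 0 \<and> Suc j = length p \<or> j = 0 \<and> Suc i = length p"
    by (rule hamiltonian_path[OF fin connected_set_V deg], assumption, rule that)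
  have no_D: "\<not> (\<exists>D. isolates V D \<and> 4 * card D \<le> card V)" using cex by (meson not_le)
  have n: "length p = card V" using p distinct_card by metis
  have n3: "length p \<noteq> 3" using n not_exceptional connected_set_V unfolding exceptional_def by metis
  have n2: "length p > 2"
  proof (rule ccontr)
    assume "\<not> length p > 2"
    then have "sparse V" using n fin by (intro sparse_card_le_2) simp_all
    then have "isolates V {}" unfolding isolates_def closed_nbhd_def by simp
    then show False using cex by fastforce
  qed
  have next_iff: "E (p ! i) (p ! j)" if "i < length p" "j < length p" "j = Suc i
      \<or> i = Suc j" for i j
    using that step E_sym by blast
  show False
  \<comment> \<open>Only the ends of \<open>p\<close> can be adjacent without being consecutive, so
    \<open>V\<close> induces a path or a cycle.\<close>
  proof (cases "E (p ! 0) (p ! (length p - 1))")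
    case False
    have "E (p ! i) (p ! j) \<longleftrightarrow> j = Suc i \<or> i = Suc j" if ij: "i < length p" "j < length p" for i j
    proof
      assume e: "E (p ! i) (p ! j)"
      have "\<not> (i = 0 \<and> Suc j = length p)" "\<not> (j = 0 \<and> Suc i = length p)"
        using False e E_sym by (metis diff_Suc_1)+
      then show "j = Suc i \<or> i = Suc j" using adj[OF ij e] by blast
    qed (rule next_iff[OF ij])
    then show False using isolating_path[OF p n3] no_D by blast
  next
    case True
    have E: "E (p ! i) (p ! j) \<longleftrightarrow>
       j = Suc i \<or> i = Suc j \<or> i = 0 \<and> Suc j = length p \<or> j = 0 \<and> Suc i = length p"
      if ij: "i < length p" "j < length p" for i j
    proof
      assume "j = Suc i \<or> i = Suc j \<or> i = 0 \<and> Suc j = length p \<or> j = 0 \<and> Suc i = length p"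
      then show "E (p ! i) (p ! j)"
        using next_iff[OF ij] True E_sym by (metis diff_Suc_1)
    qed (rule adj[OF ij])
    \<comment> \<open>Beyond length two, \<open>isolating_cycle\<close> omits 3, 6, 7 and 11. Length
      6 contradicts \<open>no_C6\<close>; the others would make \<open>V\<close>
      exceptional.\<close>
    have "length p \<noteq> 6"
    proof
      assume 6: "length p = 6"
      have d: "distinct [p ! 0, p ! 1, p ! 2, p ! 3, p ! 4, p ! 5]"
        using p(2) 6 by (simp add: nth_eq_iff_index_eq)
      have v: "p ! i \<in> V" if "i < 6" for i using that 6 p(1) by auto
      show False
        by (rule C6_free[OF v v v v v v d]) (use E 6 in simp_all)
    qed
    moreover have "length p \<noteq> 7"
      using cycle_on_of_list[OF p, of 7] E not_exceptional unfolding exceptional_def by auto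
    moreover have "length p \<noteq> 11"
      using cycle_on_of_list[OF p, of 11] E not_exceptional unfolding exceptional_def by auto
    ultimately have "length p \<notin> {0, 1, 2, 3, 6, 7, 11}" using n2 n3 by auto
    then show False using isolating_cycle[OF p _ E] no_D by blast
  qed
qed

text \<open>Under induction over proper subsets, a set violating the bound instantiates
  \<open>minimal_counterexample\<close>.\<close>

theorem (in simple_rel) isolating_set:
  assumes "finite S" "connected_set S" "\<not> has_C6 S" "\<not> exceptional S"
  shows "\<exists>D. isolates S D \<and> 4 * card D \<le> card S"
  using assms
proof (induction S rule: finite_psubset_induct)
  case (psubset S)
  show ?case
  proof (rule ccontr)
    assume no: "\<not> ?thesis"
    interpret minimal_counterexample E S
    proof
      show "\<exists>D. isolates T D \<and> 4 * card D \<le> card T" if "T \<subset> S" "connected_set T"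
          "\<not> exceptional T" for T
      proof (rule psubset.IH[OF that(1,2) _ that(3)])
        show "\<not> has_C6 T" using psubset.prems(2) that(1) unfolding has_C6_def
            by (meson psubsetE subset_trans)
      qed
      show "card S < 4 * card D" if "isolates S D" for D using no that by (meson not_le)
    qed (use psubset in blast)+
    show False by (rule contradiction)
  qed
qed

subsection \<open>Transfer to digraphs\<close>

text \<open>The map \<open>g\<close> goes from the model \<open>H\<close> to \<open>G\<close>,
  because a labelling of \<open>G\<close> by indices is what is at hand; the isomorphism is its
  inverse \<open>f\<close>.\<close>

lemma digraph_isoI:
  fixes G :: "'a pair_pre_digraph" and H :: "'b pair_pre_digraph"
  assumes G: "pair_wf_digraph G" and H: "pair_wf_digraph H"
    and g: "bij_betw g (pverts H) (pverts G)"
    and arcs: "\<And>i j. i \<in> pverts H \<Longrightarrow> j \<in> pverts H \<Longrightarrow> (g i, g j) \<in> parcs G \<longleftrightarrow> (i, j) \<in> parcs H"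
  shows "digraph_iso G H"
proof -
  define f where "f = inv_into (pverts H) g"
  have f: "bij_betw f (pverts G) (pverts H)" unfolding f_def using g by (rule bij_betw_inv_into)
  have fg: "f (g i) = i" if "i \<in> pverts H" for i
    unfolding f_def using g that by (simp add: bij_betw_def)
  have gf: "g (f u) = u" "f u \<in> pverts H" if "u \<in> pverts G" for u
    unfolding f_def using g that by (auto simp: bij_betw_def f_inv_into_f inv_into_into)
  have wfG: "u \<in> pverts G \<and> v \<in> pverts G" if "(u, v) \<in> parcs G" for u v
    using that pair_wf_digraph.in_arcsD1[OF G] pair_wf_digraph.in_arcsD2[OF G] by blast
  have wfH: "u \<in> pverts H \<and> v \<in> pverts H" if "(u, v) \<in> parcs H" for u v
    using that pair_wf_digraph.in_arcsD1[OF H] pair_wf_digraph.in_arcsD2[OF H] by blast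
  define hom :: "('a, 'a \<times> 'a, 'b, 'b \<times> 'b) digraph_isomorphism"
    where "hom = \<lparr>iso_verts = f, iso_arcs = map_prod f f, iso_head = snd, iso_tail = fst\<rparr>"
  have inj: "inj_on f (pverts G)" using f by (rule bij_betw_imp_inj_on)
  have "inj_on (map_prod f f) (parcs G)"
  proof (rule inj_on_subset[OF map_prod_inj_on[OF inj inj]])
    show "parcs G \<subseteq> pverts G \<times> pverts G" using wfG by auto
  qed
  then have "pre_digraph.digraph_isomorphism (with_proj G) hom"
    using G inj unfolding pre_digraph.digraph_isomorphism_def hom_def
        by (simp add: wf_digraph_wp_iff)
  moreover have "with_proj H = app_iso hom (with_proj G)"
  proof -
    have "pverts H = f ` pverts G" using f by (simp add: bij_betw_def)
    moreover have "parcs H = map_prod f f ` parcs G"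
    proof
      show "parcs H \<subseteq> map_prod f f ` parcs G"
      proof
        fix e assume "e \<in> parcs H"
        moreover obtain i j where e: "e = (i, j)" by fastforce
        ultimately have "(g i, g j) \<in> parcs G" "e = map_prod f f (g i, g j)"
          using wfH[of i j] arcs[of i j] fg by auto
        then show "e \<in> map_prod f f ` parcs G" by blast
      qed
      show "map_prod f f ` parcs G \<subseteq> parcs H"
      proof (rule image_subsetI)
        fix e assume "e \<in> parcs G"
        moreover obtain u v where "e = (u, v)" by fastforce
        ultimately show "map_prod f f e \<in> parcs H"
          using wfG[of u v] arcs[of "f u" "f v"] gf by auto
      qed
    qed
    ultimately show ?thesis unfolding app_iso_def hom_def with_proj_def by simp
  qed
  ultimately show ?thesis unfolding digraph_iso_def by blast
qed

lemma pair_wf_digraph_path_graph: "pair_wf_digraph (path_graph n)"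
  by unfold_locales (auto simp: path_graph_def)

lemma pair_wf_digraph_cycle_graph: "pair_wf_digraph (cycle_graph n)"
  by unfold_locales (auto simp: cycle_graph_def)

section \<open>Connectivity, small graphs and isolation in a symmetric digraph\<close>

locale pair_graph_rel = pair_graph G for G :: "'a pair_pre_digraph"
begin

sublocale simple_rel "\<lambda>u v. (u, v) \<in> parcs G"
  using arcs_symmetric no_loops' by unfold_locales blast+

text \<open>Connectedness of a digraph is strong connectedness of its symmetric closure, which adds
  no arcs here, and no walk leaves a closed set.\<close>

lemma connected_set_pverts:
  assumes "Digraph_Component.connected (with_proj G)"
  shows "connected_set (pverts G)"
  unfolding connected_set_def
proof (intro conjI allI impI)
  have sc: "strongly_connected (with_proj (mk_symmetric (with_proj G)))"
    using assms unfolding connected_def .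
  have vs: "pverts (mk_symmetric (with_proj G)) = pverts G"
    unfolding mk_symmetric_def by simp
  have arcs: "(u, v) \<in> parcs G" if "(u, v) \<in> parcs (mk_symmetric (with_proj G))" for u v
    using that arcs_symmetric unfolding mk_symmetric_def by auto
  show "pverts G \<noteq> {}" using sc vs unfolding strongly_connected_def by simp
  fix A assume A: "closed_in (pverts G) A" "A \<noteq> {}"
  then obtain a where a: "a \<in> A" "a \<in> pverts G" unfolding closed_in_def by blast
  have "u \<in> A" if "u \<in> pverts G" for u
  proof -
    have "a \<rightarrow>\<^sup>*\<^bsub>with_proj (mk_symmetric (with_proj G))\<^esub> u"
      using sc a(2) that vs unfolding strongly_connected_def by simp
    then show ?thesis
      unfolding reachable_def
    proof (induction rule: rtrancl_on_induct)
      case base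
      show ?case by (rule a)
    next
      case (step x y)
      then have "(x, y) \<in> parcs G" using arcs by simp
      then show ?case using closed_in_D[OF A(1) step.IH] in_arcsD2 by blast
    qed
  qed
  then show "A = pverts G" using A(1) unfolding closed_in_def by blast
qed

lemma has_C6_contains_cycle:
  assumes "has_C6 (pverts G)"
  shows "contains_cycle_of_length (with_proj G) 6"
proof -
  obtain a b c d e f where C: "{a, b, c, d, e, f} \<subseteq> pverts G" "distinct [a, b, c, d, e, f]"
    "(a, b) \<in> parcs G" "(b, c) \<in> parcs G" "(c, d) \<in> parcs G" "(d, e) \<in> parcs G"
    "(e, f) \<in> parcs G" "(f, a) \<in> parcs G"
    using assms unfolding has_C6_def by metis
  let ?p = "[(a, b), (b, c), (c, d), (d, e), (e, f), (f, a)]"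
  have "pre_digraph.awalk (with_proj G) a ?p a"
    using C unfolding pre_digraph.awalk_def by (simp add: pre_digraph.cas.simps)
  moreover have "distinct (tl (pre_digraph.awalk_verts (with_proj G) a ?p))"
    using C(2) by (auto simp: pre_digraph.awalk_verts.simps)
  ultimately have "pre_digraph.cycle (with_proj G) ?p"
    unfolding pre_digraph.cycle_def by blast
  then show ?thesis unfolding contains_cycle_of_length_def by (intro exI[of _ ?p]) simp
qed

text \<open>Every vertex has a neighbour, so some vertex \<open>b\<close> is adjacent to both
  others. The remaining pair decides between path and triangle.\<close>

lemma card_3_digraph_iso:
  assumes "connected_set (pverts G)" "card (pverts G) = 3"
  shows "digraph_iso G (path_graph 3) \<or> digraph_iso G (cycle_graph 3)"
proof -
  have step: "\<exists>w\<in>pverts G - {u}. (u, w) \<in> parcs G" if "u \<in> pverts G" for u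
  proof (rule ccontr)
    assume "\<not> ?thesis"
    then have "closed_in (pverts G) {u}" using that unfolding closed_in_def by blast
    then have "pverts G = {u}" using assms(1) unfolding connected_set_def by blast
    then show False using assms(2) by simp
  qed
  have "\<exists>a b c. pverts G = {a, b, c} \<and> distinct [a, b, c] \<and> (a, b) \<in> parcs G \<and> (b, c) \<in> parcs G"
  proof -
    obtain x y z where xyz: "pverts G = {x, y, z}" "x \<noteq> y" "y \<noteq> z" "x \<noteq> z"
      using assms(2) unfolding card_3_iff by metis
    consider "(x, y) \<in> parcs G" "(y, z) \<in> parcs G" | "(x, y) \<in> parcs G" "(x, z) \<in> parcs G"
      | "(x, z) \<in> parcs G" "(y, z) \<in> parcs G"
      using step[of x] step[of y] step[of z] xyz arcs_symmetric by auto
    then consider "(x, y) \<in> parcs G" "(y, z) \<in> parcs G" | "(y, x) \<in> parcs G" "(x, z) \<in> parcs G"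
      | "(x, z) \<in> parcs G" "(z, y) \<in> parcs G"
      using arcs_symmetric by metis
    moreover have "pverts G = {y, x, z}" "pverts G = {x, z, y}" using xyz(1) by blast+
    moreover have "distinct [x, y, z]" "distinct [y, x, z]" "distinct [x, z, y]" using xyz by auto
    ultimately show ?thesis using xyz(1) by cases blast+
  qed
  then obtain a b c where abc: "pverts G = {a, b, c}" "distinct [a, b, c]" "(a, b) \<in> parcs G"
      "(b, c) \<in> parcs G"
    by blast
  define g where "g i = (if i = 0 then a else if i = Suc 0 then b else c)" for i :: nat
  have three: "{0..<3} = {0, Suc 0, Suc (Suc 0)}" by auto
  have bij: "bij_betw g {0..<3} (pverts G)"
    unfolding three abc(1) bij_betw_def inj_on_def using abc(2) by (auto simp: g_def)
  have sym: "(b, a) \<in> parcs G" "(c, b) \<in> parcs G" using abc arcs_symmetric by blast+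
  have irr: "(a, a) \<notin> parcs G" "(b, b) \<notin> parcs G" "(c, c) \<notin> parcs G" using no_loops' by blast+
  show ?thesis
  proof (cases "(a, c) \<in> parcs G")
    case True
    then have "(c, a) \<in> parcs G" using arcs_symmetric by blast
    then have "digraph_iso G (cycle_graph 3)"
      using bij True sym irr abc(3,4)
      by (intro digraph_isoI[OF pair_wf_digraph pair_wf_digraph_cycle_graph, of g])
        (auto simp: cycle_graph_def three g_def)
    then show ?thesis ..
  next
    case False
    then have "(c, a) \<notin> parcs G" using arcs_symmetric by blast
    then have "digraph_iso G (path_graph 3)"
      using bij False sym irr abc(3,4)
      by (intro digraph_isoI[OF pair_wf_digraph pair_wf_digraph_path_graph, of g])
        (auto simp: path_graph_def three g_def)
    then show ?thesis ..
  qed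
qed

text \<open>The bijection sends \<open>i\<close> to \<open>c (int i)\<close>. By
  \<open>succ\<close>, the successor modulo \<open>m\<close> on naturals becomes the divisibility
  condition of \<open>cycle_on\<close>.\<close>

lemma cycle_on_digraph_iso:
  assumes c: "cycle_on (int m) c (pverts G)"
  shows "digraph_iso G (cycle_graph m)"
proof (rule digraph_isoI[OF pair_wf_digraph pair_wf_digraph_cycle_graph])
  have V: "pverts G = c ` {0..<int m}" and eq: "\<And>i j. c i = c j \<longleftrightarrow> int m dvd i - j"
    and arc: "\<And>i j. (c i, c j) \<in> parcs G \<longleftrightarrow> int m dvd i - j - 1 \<or> int m dvd i - j + 1"
    using c unfolding cycle_on_def by blast+
  have "{0..<int m} = int ` {0..<m}" by (simp add: image_int_atLeastLessThan)
  then have im: "pverts G = (\<lambda>i. c (int i)) ` {0..<m}" unfolding V by (simp add: image_image)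
  have "card (pverts G) = m" using cycle_on_card[OF c] by simp
  then have "inj_on (\<lambda>i. c (int i)) {0..<m}" unfolding im by (intro eq_card_imp_inj_on) simp_all
  then show "bij_betw (\<lambda>i. c (int i)) (pverts (cycle_graph m)) (pverts G)"
    unfolding cycle_graph_def im by (simp add: bij_betw_def)
  fix i j assume "i \<in> pverts (cycle_graph m)" "j \<in> pverts (cycle_graph m)"
  then have ij: "i < m" "j < m" unfolding cycle_graph_def by simp_all
  have succ: "l = (k + 1) mod m \<longleftrightarrow> int m dvd int k - int l + 1" if "l < m" for k l
  proof -
    have "l = (k + 1) mod m \<longleftrightarrow> (k + 1) mod m = l mod m" using that by auto
    also have "\<dots> \<longleftrightarrow> int (k + 1) mod int m = int l mod int m"
        by (simp only: of_nat_mod[symmetric] of_nat_eq_iff)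
    also have "\<dots> \<longleftrightarrow> int m dvd int k - int l + 1" by (simp add: mod_eq_dvd_iff algebra_simps)
    finally show ?thesis .
  qed
  have "int m dvd int j - int i + 1 \<longleftrightarrow> int m dvd int i - int j - 1"
    using dvd_minus_iff[of "int m" "int j - int i + 1"] by (simp add: algebra_simps)
  then show "(c (int i), c (int j)) \<in> parcs G \<longleftrightarrow> (i, j) \<in> parcs (cycle_graph m)"
    using ij succ[of j i] succ[of i j] unfolding arc cycle_graph_def by auto
qed

text \<open>Two remaining arcs out of \<open>u\<close> have the same head by sparseness, so they are
  equal and the out-degree is at most one.\<close>

lemma isolates_one_isolating:
  assumes D: "isolates (pverts G) D"
  shows "one_isolating (with_proj G) D"
proof -
  let ?S = "pverts G - closed_neighborhood (with_proj G) D"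
  have "?S = pverts G - closed_nbhd D"
    unfolding closed_neighborhood_def closed_nbhd_def by auto
  then have sp: "sparse ?S" and sub: "D \<subseteq> pverts G" using D unfolding isolates_def by simp_all
  have "out_degree (with_proj G \<restriction> ?S) u \<le> 1" if "u \<in> ?S" for u
  proof -
    let ?A = "out_arcs (with_proj G \<restriction> ?S) u"
    have A: "fst e = u" "e \<in> parcs G" "snd e \<in> ?S" if "e \<in> ?A" for e
      using that unfolding out_arcs_def by auto
    have "finite ?A" using A(2) pair_finite_arcs by (meson finite_subset subsetI)
    moreover have "e = e'" if "e \<in> ?A" "e' \<in> ?A" for e e'
      using A[OF that(1)] A[OF that(2)] sp \<open>u \<in> ?S\<close> unfolding sparse_def by (metis prod.collapse)
    ultimately show ?thesis
      unfolding out_degree_def One_nat_def using card_le_Suc0_iff_eq[of ?A] by blast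
  qed
  then have "max_degree (with_proj G \<restriction> ?S) \<le> 1"
    unfolding max_degree_def using pair_finite_verts by (intro Max.boundedI) auto
  then show ?thesis using sub unfolding one_isolating_def by simp
qed

end

theorem theorem1p6:
  fixes G :: "'a pair_pre_digraph" and n :: nat
  assumes "pair_graph G"
    and "Digraph_Component.connected G"
    and "card (pverts G) = n"
    and "\<not> contains_cycle_of_length G 6"
    and "\<not> digraph_iso G (path_graph 3)"
    and "\<not> digraph_iso G (cycle_graph 3)"
    and "\<not> digraph_iso G (cycle_graph 7)"
    and "\<not> digraph_iso G (cycle_graph 11)"
  shows "real (one_isolation_number G) \<le> real n / 4"
proof -
  interpret pair_graph_rel G using assms(1) unfolding pair_graph_rel_def .
  have "\<not> exceptional (pverts G)"
    using card_3_digraph_iso cycle_on_digraph_iso[of 7] cycle_on_digraph_iso[of 11] assms(5-8)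
    unfolding exceptional_def by auto
  then obtain D where D: "isolates (pverts G) D" "4 * card D \<le> card (pverts G)"
    using isolating_set[OF pair_finite_verts connected_set_pverts[OF assms(2)]]
        has_C6_contains_cycle assms(4) by blast
  have "one_isolation_number G \<le> card D"
    unfolding one_isolation_number_def using isolates_one_isolating[OF D(1)]
        by (intro Least_le) blast
  then show ?thesis using D(2) assms(3) by simp
qed

end
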